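(* Let $\psi(z)=z^4$ and $d=2$. Suppose that $\boldsymbol f_*\in\mathcal{F}^{\mathrm L}_{\mathrm{INV}}$ and that the following assumption holds: there exist an estimator $\hat{\boldsymbol f}_n^{(1)}:I^2\to I^2$ and $C>0$ such that $$\mathbb{P}\Big(\|\hat{\boldsymbol f}_n^{(1)}-\boldsymbol f_*\|_{L^\infty}\le C\,n^{-1/(2+d)}(\log n)^{\alpha}\Big)\ge 1-\delta_n$$ holds for sufficiently large $n$, with some $\alpha>0$ and a sequence $\delta_n\searrow0$ as $n\to\infty$. Then, for any $\beta>0$, there exists $\overline{C}\in(0,\infty)$ such that $$\inf_{\bar{\boldsymbol f}_n}\ \sup_{\boldsymbol f_*\in\mathcal{F}^{\mathrm L}_{\mathrm{INV}}}\ \mathsf{R}_{\mathrm{INV}}(\bar{\boldsymbol f}_n,\boldsymbol f_* )\ \le\ \overline{C}\,n^{-2/(2+d)}(\log n)^{2\alpha+2\beta}$$ holds for any sufficiently large $n$, where the infimum is taken over all measurable estimators depending on $\mathcal{D}_n$.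
   Context: Let $d=2$ and $I=[-1,1]$. $\mathcal{F}^{\mathrm L}_{\mathrm{INV}}$ is the set of functions $\boldsymbol f:I^2\to I^2$ such that for every $\boldsymbol y\in I^2$ there is a unique $\boldsymbol x\in I^2$ with $\boldsymbol f(\boldsymbol x)=\boldsymbol y$, and that are bi-Lipschitz, i.e. there is some $L\ge 1$ with $L^{-1}\|\boldsymbol x-\boldsymbol x'\|_2\le\|\boldsymbol f(\boldsymbol x)-\boldsymbol f(\boldsymbol x')\|_2\le L\|\boldsymbol x-\boldsymbol x'\|_2$ for all $\boldsymbol x,\boldsymbol x'\in I^2$. Model: the observations $\mathcal{D}_n=\{(\boldsymbol X_i,\boldsymbol Y_i)\}_{i=1}^n\subset I^2\times\mathbb{R}^2$ are i.i.d. and follow $\boldsymbol Y_i=\boldsymbol f_*(\boldsymbol X_i)+\boldsymbol\varepsilon_i$, with $\boldsymbol\varepsilon_i\sim N_2(\boldsymbol 0,\sigma^2\boldsymbol I_2)$ i.i.d., $\sigma^2>0$, where $\boldsymbol f_*\in\mathcal{F}^{\mathrm L}_{\mathrm{INV}}$ is the true function. The marginal measure $P_{\boldsymbol X}$ of $\boldsymbol X_i$ has a density that is positive and bounded on $I^2$. $\mathbb{E}_n$ is the expectation with respect to $\mathcal{D}_n$. For an estimator $\bar{\boldsymbol f}_n$, its quasi-inverse is defined for $\boldsymbol y\in I^2$ by $\bar{\boldsymbol f}_n^{\ddagger}(\boldsymbol y)=\boldsymbol x$ if $\boldsymbol x\in I^2$ is the unique point with $\bar{\boldsymbol f}_n(\boldsymbol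 x)=\boldsymbol y$, and $\bar{\boldsymbol f}_n^{\ddagger}(\boldsymbol y)=\boldsymbol c$ otherwise, where $\boldsymbol c\in\mathbb{R}^2\setminus I^2$ is some constant vector. For vector-valued $\boldsymbol f=(f_1,f_2)$ on $I^2$, $\|\boldsymbol f\|_{L^\infty}=\max_j\sup_{\boldsymbol x}|f_j(\boldsymbol x)|$ and $\|\boldsymbol f\|_{L^2(P_{\boldsymbol X})}=(\sum_{j=1}^2\int|f_j|^2\,dP_{\boldsymbol X})^{1/2}$. The inverse risk with penalty function $\psi$ is $$\mathsf{R}_{\mathrm{INV}}(\bar{\boldsymbol f}_n,\boldsymbol f_* )=\mathbb{E}_n\Big[\|\bar{\boldsymbol f}_n-\boldsymbol f_*\|_{L^2(P_{\boldsymbol X})}^2+\psi\big(\|\bar{\boldsymbol f}_n^{\ddagger}-\boldsymbol f_*^{-1}\|_{L^2(P_{\boldsymbol X})}\big)\Big].$$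
   Formalization: The assumption on the first-stage estimator is taken uniformly over the true function (same estimator, C, α, δ_n, threshold), and the class may have a common bound on L, finite or infinite; for a single fixed true function and unrestricted L the claim as written fails. *)

theory Defs
  imports "HOL-Probability.Probability"
begin

definition square :: "(real^2) set" where
  "square = cbox (- 1) 1"

definition bi_Lipschitz_on :: "real \<Rightarrow> (real^2) set \<Rightarrow> (real^2 \<Rightarrow> real^2) \<Rightarrow> bool" where
  "bi_Lipschitz_on L S f \<longleftrightarrow>
     (\<forall>x\<in>S. \<forall>x'\<in>S. inverse L * norm (x - x') \<le> norm (f x - f x') \<and>
                     norm (f x - f x') \<le> L * norm (x - x'))"

text \<open>
  The class of invertible bi-Lipschitz self-maps of the square. For \<open>\<Lambda> = \<infinity>\<close> this is the class of all
  such maps, each with its own constant \<open>L\<close>; for finite \<open>\<Lambda>\<close> it is the class with the common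
  constant \<open>\<Lambda>\<close>. The functions are total on the plane, but everything below depends on their values
  on the square only.
\<close>
definition F_INV_Lip :: "ereal \<Rightarrow> (real^2 \<Rightarrow> real^2) set" where
  "F_INV_Lip \<Lambda> = {f. f ` square \<subseteq> square \<and>
      (\<forall>y\<in>square. \<exists>!x. x \<in> square \<and> f x = y) \<and>
      (\<exists>L\<ge>1. ereal L \<le> \<Lambda> \<and> bi_Lipschitz_on L square f)}"

definition design_density :: "(real^2 \<Rightarrow> real) \<Rightarrow> bool" where
  "design_density p \<longleftrightarrow>
     p \<in> borel_measurable (restrict_space borel square) \<and>
     (\<forall>x\<in>square. 0 < p x) \<and> (\<exists>M. \<forall>x\<in>square. p x \<le> M) \<and>
     (\<integral>\<^sup>+x. ennreal (p x) \<partial>restrict_space lborel square) = 1"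

text \<open>
  The covariate law lives on the subspace \<open>square\<close>, so that a function that is continuous on the
  square is measurable for it regardless of its values elsewhere.
\<close>
definition design_law :: "(real^2 \<Rightarrow> real) \<Rightarrow> (real^2) measure" where
  "design_law p = density (restrict_space lborel square) (\<lambda>x. ennreal (p x))"

text \<open>The centred Gaussian law on the plane with covariance matrix \<open>\<sigma>\<^sup>2\<close> times the identity.\<close>
definition noise_law :: "real \<Rightarrow> (real^2) measure" where
  "noise_law \<sigma> = density lborel (\<lambda>e. ennreal (\<Prod>j\<in>UNIV. normal_density 0 \<sigma> (e $ j)))"

definition obs_space :: "((real^2) \<times> (real^2)) measure" where
  "obs_space = restrict_space borel square \<Otimes>\<^sub>M borel"

text \<open>The joint law of \<open>(X, f X + \<epsilon>)\<close> with \<open>X\<close> and \<open>\<epsilon>\<close> independent.\<close>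
definition obs_law ::
  "(real^2 \<Rightarrow> real) \<Rightarrow> real \<Rightarrow> (real^2 \<Rightarrow> real^2) \<Rightarrow> ((real^2) \<times> (real^2)) measure" where
  "obs_law p \<sigma> f = distr (design_law p \<Otimes>\<^sub>M noise_law \<sigma>) obs_space (\<lambda>(x, e). (x, f x + e))"

type_synonym data = "nat \<Rightarrow> (real^2) \<times> (real^2)"

definition data_space :: "nat \<Rightarrow> data measure" where
  "data_space n = Pi\<^sub>M {..<n} (\<lambda>_. obs_space)"

definition data_law ::
  "(real^2 \<Rightarrow> real) \<Rightarrow> real \<Rightarrow> nat \<Rightarrow> (real^2 \<Rightarrow> real^2) \<Rightarrow> data measure" where
  "data_law p \<sigma> n f = Pi\<^sub>M {..<n} (\<lambda>_. obs_law p \<sigma> f)"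

type_synonym estimator = "data \<Rightarrow> real^2 \<Rightarrow> real^2"

definition estimators :: "nat \<Rightarrow> estimator set" where
  "estimators n = {g. (\<lambda>(D, x). g D x) \<in>
      borel_measurable (data_space n \<Otimes>\<^sub>M restrict_space borel square)}"

text \<open>
  Norms are valued in \<open>ennreal\<close>: an estimator need not be bounded or square integrable, and a
  Bochner integral would then evaluate to \<open>0\<close> instead of infinity.
\<close>
definition Linf_norm :: "(real^2 \<Rightarrow> real^2) \<Rightarrow> ennreal" where
  "Linf_norm f = Max (range (\<lambda>j. SUP x\<in>square. ennreal \<bar>f x $ j\<bar>))"

definition ennreal_sqrt :: "ennreal \<Rightarrow> ennreal" where
  "ennreal_sqrt z = (if z = \<top> then \<top> else ennreal (sqrt (enn2real z)))"

definition L2_norm :: "(real^2) measure \<Rightarrow> (real^2 \<Rightarrow> real^2) \<Rightarrow> ennreal" where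
  "L2_norm P f = ennreal_sqrt (\<Sum>j\<in>UNIV. \<integral>\<^sup>+x. ennreal (\<bar>f x $ j\<bar> ^ 2) \<partial>P)"

definition quasi_inverse :: "real^2 \<Rightarrow> (real^2 \<Rightarrow> real^2) \<Rightarrow> real^2 \<Rightarrow> real^2" where
  "quasi_inverse c f y =
     (if \<exists>!x. x \<in> square \<and> f x = y then THE x. x \<in> square \<and> f x = y else c)"

text \<open>
  For a jointly Borel estimator the quasi-inverse is in general only universally measurable, because
  unique solvability is a coanalytic condition. The nonnegative integral is defined from below by
  simple functions and agrees with the integral for the completed measure on such functions.
\<close>
definition inverse_risk ::
  "(ennreal \<Rightarrow> ennreal) \<Rightarrow> real^2 \<Rightarrow> (real^2 \<Rightarrow> real) \<Rightarrow> real \<Rightarrow> nat \<Rightarrow>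
     estimator \<Rightarrow> (real^2 \<Rightarrow> real^2) \<Rightarrow> ennreal" where
  "inverse_risk \<psi> c p \<sigma> n g f =
     (\<integral>\<^sup>+D. (L2_norm (design_law p) (\<lambda>x. g D x - f x)) ^ 2 +
            \<psi> (L2_norm (design_law p) (\<lambda>y. quasi_inverse c (g D) y - inv_into square f y))
      \<partial>data_law p \<sigma> n f)"

text \<open>
  The event is a coanalytic set (a supremum over uncountably many points), hence measurable for the
  completion, although not Borel in general.
\<close>
definition Linf_error_prob ::
  "(real^2 \<Rightarrow> real) \<Rightarrow> real \<Rightarrow> nat \<Rightarrow> estimator \<Rightarrow> (real^2 \<Rightarrow> real^2) \<Rightarrow> real \<Rightarrow> real" where
  "Linf_error_prob p \<sigma> n g f r =
     measure (completion (data_law p \<sigma> n f))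
       {D \<in> space (data_space n). Linf_norm (\<lambda>x. g D x - f x) \<le> ennreal r}"

end

theory Submission
  imports Defs "HOL-Real_Asymp.Real_Asymp"
begin

text \<open>
  For a finite Lipschitz bound the class is totally bounded, and the estimator picks an element of a
  finite uniform net of the class, so its quasi-inverse is a true inverse and inherits uniform errors.
  With \<open>k\<close> the integer part of the fourth root of \<open>n\<close>, the given estimator is applied to \<open>k\<close> disjoint
  blocks of \<open>k\<^sup>3\<close> observations; net elements that are uniformly close to a majority of the \<open>k\<close> results
  are within \<open>k\<close> to the power \<open>-3/4\<close> of the truth, up to logarithms, except on an event of probability
  \<open>2\<close> to the power \<open>-k\<close>, however slowly \<open>\<delta>\<close> tends to zero. This is ample for the fourth power of the
  inverse error. Among these candidates the one closest to a histogram in the \<open>L\<^sup>2\<close> norm of the design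
  attains the squared error \<open>k\<close> to the power \<open>-2\<close>, without logarithms.

  Without a common Lipschitz constant the assumption fails: two maps can agree off a strip so thin
  that no observation falls into it, and still differ by \<open>1/2\<close> inside it.
\<close>

section \<open>Independent observations and blocks\<close>

text \<open>Used once on the whole sample, the given estimator leaves a failure event of probability
  up to \<open>\<delta> n\<close> on which the risk can be of constant order, and
  \<open>\<delta>\<close> may decay more slowly than any power of \<open>n\<close>. Voting among
  blocks only asks each block to fail with probability at most 1/15. The sizes are forced by the
  target \<open>n^(-1/2)\<close>, that is \<open>k^(-2)\<close>: a block of \<open>k^3\<close>
  observations has accuracy of order \<open>k^(-3/4)\<close>, whose fourth power
  \<open>k^(-3)\<close> is below the target, logarithms included, while its square
  \<open>k^(-3/2)\<close> is above it. So uniform closeness settles the penalty but not the direct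
  error, and a second criterion is required. A histogram with of the order of \<open>k^2\<close>
  cells of diameter of order \<open>1/k\<close> has squared bias and variance both of order
  \<open>k^(-2)\<close>. The two criteria do not compete: the vote only restricts the candidates,
  the net point next to the truth survives it, and minimising the distance to the histogram among
  the survivors is then compared with that net point. Votes compare functions at finitely many
  points only, which keeps the selection measurable although the uniform norm is a supremum over an
  uncountable set.\<close>

lemma indep_vars_PiM_coordinates:
  assumes "\<And>i. i \<in> I \<Longrightarrow> prob_space (M i)"
  shows "prob_space.indep_vars (PiM I M) M (\<lambda>i \<omega>. \<omega> i) I"
proof (cases "I = {}")
  interpret prob_space "PiM I M" using assms by (rule prob_space_PiM)
  case True
  show ?thesis unfolding indep_vars_def indep_sets_def using True by auto
next
  interpret prob_space "PiM I M" using assms by (rule prob_space_PiM)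
  case False
  \<comment> \<open>Independence means that the joint law of the coordinates is the product of their
    marginals, and the joint map is the identity on the product space. The criterion is stated for
    nonempty index sets, hence the case split.\<close>
  have "distr (PiM I M) (PiM I M) (\<lambda>x. \<lambda>i\<in>I. x i) = distr (PiM I M) (PiM I M) (\<lambda>x. x)"
    by (intro distr_cong) (auto simp: space_PiM PiE_def extensional_restrict)
  also have "\<dots> = PiM I (\<lambda>i. distr (PiM I M) (M i) (\<lambda>x. x i))"
    using assms by (auto simp: distr_id2 intro!: PiM_cong distr_PiM_component[symmetric])
  finally show ?thesis
    using False by (subst indep_vars_iff_distr_eq_PiM') auto
qed

text \<open>Expand the square into a double sum: independence and the zero mean kill every
  off-diagonal term, and the \<open>n\<close> diagonal terms are equal.\<close>

lemma second_moment_sum_iid: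
  fixes z :: "'a \<Rightarrow> real"
  assumes M: "prob_space M" and z: "integrable M z" "integrable M (\<lambda>x. (z x)\<^sup>2)" "(\<integral>x. z x \<partial>M) = 0"
  shows "integrable (PiM {..<n::nat} (\<lambda>_. M)) (\<lambda>D. (\<Sum>i<n. z (D i))\<^sup>2)"
    and "(\<integral>D. (\<Sum>i<n. z (D i))\<^sup>2 \<partial>PiM {..<n} (\<lambda>_. M)) = real n * (\<integral>x. (z x)\<^sup>2 \<partial>M)"
proof -
  let ?P = "PiM {..<n} (\<lambda>_. M)"
  interpret P: prob_space ?P using M by (intro prob_space_PiM) auto
  note zm[measurable] = borel_measurable_integrable[OF z(1)]
  have comp: "integrable ?P (\<lambda>D. h (D i)) \<longleftrightarrow> integrable M h"
       "(\<integral>D. h (D i) \<partial>?P) = (\<integral>x. h x \<partial>M)"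
    if "i < n" "h \<in> borel_measurable M" for i and h :: "'a \<Rightarrow> real"
  proof -
    have d: "distr ?P M (\<lambda>D. D i) = M"
      using that M by (intro distr_PiM_component) auto
    have m: "(\<lambda>D. D i) \<in> measurable ?P M" using that by auto
    show "integrable ?P (\<lambda>D. h (D i)) \<longleftrightarrow> integrable M h"
      using integrable_distr_eq[OF m that(2)] d by simp
    show "(\<integral>D. h (D i) \<partial>?P) = (\<integral>x. h x \<partial>M)"
      using integral_distr[OF m that(2)] d by simp
  qed
  have prod: "integrable ?P (\<lambda>D. z (D i) * z (D j)) \<and>
      (\<integral>D. z (D i) * z (D j) \<partial>?P) = (if i = j then \<integral>x. (z x)\<^sup>2 \<partial>M else 0)"
    if ij: "i < n" "j < n" for i j
  proof (cases "i = j")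
    case True
    then show ?thesis
      using comp[OF ij(1), of "\<lambda>x. (z x)\<^sup>2"] z by (simp add: power2_eq_square)
  next
    case False
    have "P.indep_vars (\<lambda>_. M) (\<lambda>i \<omega>. \<omega> i) {i, j}"
      using indep_vars_PiM_coordinates[of "{..<n}" "\<lambda>_. M"] M ij
      by (auto intro: P.indep_vars_subset)
    then have ind: "P.indep_vars (\<lambda>_. borel) (\<lambda>i \<omega>. z (\<omega> i)) {i, j}"
      by (rule P.indep_vars_compose2) simp
    have int: "integrable ?P (\<lambda>\<omega>. z (\<omega> k))" if "k \<in> {i, j}" for k
      using that ij comp(1)[of _ z] z by auto
    show ?thesis
      using P.indep_vars_lebesgue_integral[OF _ ind int] P.indep_vars_integrable[OF _ ind int]
        False comp(2)[OF ij(1) zm] z(3) by simp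
  qed
  have sq: "(\<Sum>i<n. z (D i))\<^sup>2 = (\<Sum>i<n. \<Sum>j<n. z (D i) * z (D j))" for D
    by (simp add: power2_eq_square sum_product)
  show "integrable ?P (\<lambda>D. (\<Sum>i<n. z (D i))\<^sup>2)"
    unfolding sq using prod by (intro Bochner_Integration.integrable_sum) auto
  have "(\<integral>D. (\<Sum>i<n. z (D i))\<^sup>2 \<partial>?P) = (\<Sum>i<n. \<Sum>j<n. \<integral>D. z (D i) * z (D j) \<partial>?P)"
    unfolding sq using prod
    by (subst Bochner_Integration.integral_sum, force)+ simp
  also have "\<dots> = (\<Sum>i<n. \<Sum>j<n. if i = j then \<integral>x. (z x)\<^sup>2 \<partial>M else 0)"
    using prod by (intro sum.cong) auto
  also have "\<dots> = real n * (\<integral>x. (z x)\<^sup>2 \<partial>M)"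
    by simp
  finally show "(\<integral>D. (\<Sum>i<n. z (D i))\<^sup>2 \<partial>?P) = real n * (\<integral>x. (z x)\<^sup>2 \<partial>M)" .
qed

text \<open>The variance is bounded by the raw second moment, which is the quantity available for
  the cell indicators. The extended nonnegative integral is used because the risks are defined with
  it.\<close>

lemma mean_square_error_iid:
  fixes z :: "'a \<Rightarrow> real"
  assumes M: "prob_space M" and z: "integrable M z" "integrable M (\<lambda>x. (z x)\<^sup>2)" and n: "0 < n"
  shows "(\<integral>\<^sup>+D. ennreal (((\<Sum>i<n. z (D i)) / real n - (\<integral>x. z x \<partial>M))\<^sup>2) \<partial>PiM {..<n} (\<lambda>_. M))
    \<le> ennreal ((\<integral>x. (z x)\<^sup>2 \<partial>M) / real n)"
proof -
  interpret prob_space M by fact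
  define w where "w = (\<integral>x. z x \<partial>M)"
  let ?y = "\<lambda>x. z x - w" and ?P = "PiM {..<n} (\<lambda>_. M)"
  have yy: "(?y x)\<^sup>2 = (z x)\<^sup>2 - 2 * w * z x + w\<^sup>2" for x
    by (simp add: power2_eq_square algebra_simps)
  have iy: "integrable M ?y" "integrable M (\<lambda>x. (?y x)\<^sup>2)" "(\<integral>x. ?y x \<partial>M) = 0"
    unfolding yy using z by (auto simp: w_def prob_space)
  have vy: "(\<integral>x. (?y x)\<^sup>2 \<partial>M) \<le> (\<integral>x. (z x)\<^sup>2 \<partial>M)"
    unfolding yy using z by (simp add: prob_space w_def[symmetric] power2_eq_square)
  have "(\<Sum>i<n. z (D i)) / real n - w = (\<Sum>i<n. ?y (D i)) / real n" for D
    using n by (simp add: sum_subtractf field_simps)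
  then have "(\<integral>\<^sup>+D. ennreal (((\<Sum>i<n. z (D i)) / real n - w)\<^sup>2) \<partial>?P)
     = (\<integral>\<^sup>+D. ennreal ((\<Sum>i<n. ?y (D i))\<^sup>2 / (real n)\<^sup>2) \<partial>?P)"
    by (simp add: power_divide)
  also have "\<dots> = ennreal (\<integral>D. (\<Sum>i<n. ?y (D i))\<^sup>2 / (real n)\<^sup>2 \<partial>?P)"
    using second_moment_sum_iid(1)[OF M iy] by (intro nn_integral_eq_integral) auto
  also have "\<dots> = ennreal ((\<integral>x. (?y x)\<^sup>2 \<partial>M) / real n)"
    using second_moment_sum_iid(2)[OF M iy, of n] n by (simp add: power2_eq_square)
  also have "\<dots> \<le> ennreal ((\<integral>x. (z x)\<^sup>2 \<partial>M) / real n)"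
    using vy by (intro ennreal_leI divide_right_mono) auto
  finally show ?thesis by (simp add: w_def)
qed

text \<open>Block \<open>j\<close> is shifted back to the indices below \<open>m\<close> and made
  extensional, so that it is a data set of size \<open>m\<close> to which an estimator for
  \<open>m\<close> observations applies.\<close>

definition block :: "nat \<Rightarrow> nat \<Rightarrow> (nat \<Rightarrow> 'a) \<Rightarrow> nat \<Rightarrow> 'a" where
  "block m j D = (\<lambda>i\<in>{..<m}. D (j * m + i))"

lemma block_index_less:
  assumes "j < K" "i < m" "K * m \<le> (n::nat)"
  shows "j * m + i < n"
proof -
  have "j * m + i < Suc j * m" using assms by simp
  also have "\<dots> \<le> K * m" using assms by (intro mult_right_mono) auto
  finally show ?thesis using assms by simp
qed

lemma measurable_block:
  assumes "j < K" "K * m \<le> n"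
  shows "block m j \<in> measurable (PiM {..<n} (\<lambda>_. M)) (PiM {..<m} (\<lambda>_. M))"
  unfolding block_def using block_index_less[OF assms(1) _ assms(2)]
  by (intro measurable_restrict measurable_component_singleton) auto

lemma distr_block:
  assumes "prob_space M" "j < K" "K * m \<le> n"
  shows "distr (PiM {..<n} (\<lambda>_. M)) (PiM {..<m} (\<lambda>_. M)) (block m j) = PiM {..<m} (\<lambda>_. M)"
  using distr_PiM_reindex[of "{..<n}" "\<lambda>_. M" "\<lambda>i. j * m + i" "{..<m}"]
    block_index_less[OF assms(2) _ assms(3)] assms(1)
  by (simp add: block_def[abs_def] inj_on_def Pi_iff)

text \<open>The blocks read pairwise disjoint sets of coordinates, and functions of disjoint
  families of independent coordinates are independent.\<close>

lemma indep_vars_blocks: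
  assumes M: "prob_space M" and Km: "K * m \<le> n"
  shows "prob_space.indep_vars (PiM {..<n} (\<lambda>_. M)) (\<lambda>_. PiM {..<m} (\<lambda>_. M)) (block m) {..<K}"
proof -
  let ?P = "PiM {..<n} (\<lambda>_. M)"
  interpret P: prob_space ?P using M by (intro prob_space_PiM) auto
  let ?B = "\<lambda>j. (\<lambda>i. j * m + i) ` {..<m}"
  have sub: "?B j \<subseteq> {..<n}" if "j \<in> {..<K}" for j
    using block_index_less[of j K _ m n] that Km by auto
  have disj: "disjoint_family_on ?B {..<K}"
    unfolding disjoint_family_on_def
  proof (intro ballI impI equals0I)
    fix j j' x assume "j \<noteq> j'" "x \<in> ?B j \<inter> ?B j'"
    then obtain i where i0: "x = j * m + i" "i < m" by blast
    obtain i' where i1: "x = j' * m + i'" "i' < m" using \<open>x \<in> ?B j \<inter> ?B j'\<close> by blast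
    \<comment> \<open>The offset inside a block is below \<open>m\<close>, so division by
      \<open>m\<close> recovers the number of the block.\<close>
    have "x div m = j" "x div m = j'"
      using i0 i1 by (metis add.commute add.right_neutral div_less div_mult_self3 less_nat_zero_code)+
    then show False using \<open>j \<noteq> j'\<close> by simp
  qed
  have 1: "P.indep_vars (\<lambda>j. PiM (?B j) (\<lambda>_. M)) (\<lambda>j \<omega>. restrict \<omega> (?B j)) {..<K}"
    using P.indep_vars_restrict[OF indep_vars_PiM_coordinates[of "{..<n}" "\<lambda>_. M"] sub disj] M
    by simp
  \<comment> \<open>The inner restriction presents each block as a function of its own coordinates;
    it is then removed because \<open>block\<close> reads nothing else.\<close>
  have "P.indep_vars (\<lambda>_. PiM {..<m} (\<lambda>_. M)) (\<lambda>j \<omega>. block m j (restrict \<omega> (?B j))) {..<K}"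
    by (rule P.indep_vars_compose2[OF 1])
       (auto simp: block_def[abs_def] simp del: restrict_apply intro!: measurable_restrict measurable_component_singleton)
  moreover have "block m j (restrict \<omega> (?B j)) = block m j \<omega>" for j and \<omega> :: "nat \<Rightarrow> 'a"
    by (auto simp: block_def fun_eq_iff)
  ultimately show ?thesis by simp
qed

text \<open>Markov's inequality for \<open>16\<close> to the number of blocks outside \<open>S\<close>.\<close>
lemma emeasure_few_good_blocks:
  assumes M: "prob_space M" and Km: "K * m \<le> n"
    and S: "S \<in> sets (PiM {..<m} (\<lambda>_. M))" "measure (PiM {..<m} (\<lambda>_. M)) S \<ge> 1 - \<delta>" "\<delta> \<le> 1/15"
  shows "emeasure (PiM {..<n} (\<lambda>_. M))
    {D \<in> space (PiM {..<n} (\<lambda>_. M)). 2 * card {j. j < K \<and> block m j D \<in> S} \<le> K} \<le> ennreal ((1/2) ^ K)"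
proof -
  let ?P = "PiM {..<n} (\<lambda>_. M)" and ?Q = "PiM {..<m} (\<lambda>_. M)"
  interpret P: prob_space ?P using M by (intro prob_space_PiM) auto
  interpret Q: prob_space ?Q using M by (intro prob_space_PiM) auto
  \<comment> \<open>A good block has weight 1 and a bad one 16. With failure probability at most
    1/15 the mean weight is at most \<open>1 + 15/15 = 2\<close>, so the product over the blocks has
    mean at most \<open>2^K\<close>. If at least half of the blocks are bad, the product is at least
    \<open>16^(K/2) = 4^K\<close>, and Markov leaves \<open>2^K / 4^K\<close>.\<close>
  define Z :: "(nat \<Rightarrow> 'a) \<Rightarrow> ennreal" where "Z = (\<lambda>D. if D \<in> S then 1 else 16)"
  have Zm[measurable]: "Z \<in> borel_measurable ?Q"
    unfolding Z_def using S(1) by measurable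
  have EZ: "(\<integral>\<^sup>+D. Z D \<partial>?Q) \<le> 2"
  proof -
    have "(\<integral>\<^sup>+D. Z D \<partial>?Q) = (\<integral>\<^sup>+D. 1 * indicator S D + 16 * indicator (space ?Q - S) D \<partial>?Q)"
      by (intro nn_integral_cong) (auto simp: Z_def split: split_indicator)
    also have "\<dots> = emeasure ?Q S + 16 * emeasure ?Q (space ?Q - S)"
      using S(1) by (subst nn_integral_add) (auto simp: nn_integral_cmult)
    also have "\<dots> = ennreal (Q.prob S + 16 * (1 - Q.prob S))"
      by (subst ennreal_plus, simp, simp, subst ennreal_mult)
         (use Q.prob_compl[OF S(1)] in \<open>auto simp: Q.emeasure_eq_measure\<close>)
    also have "\<dots> \<le> ennreal 2"
    proof (intro ennreal_leI)
      have "15 * (1 - \<delta>) \<le> 15 * Q.prob S" using S(2) by (rule mult_left_mono) simp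
      moreover have "15 * \<delta> \<le> 1" using S(3) by simp
      ultimately show "Q.prob S + 16 * (1 - Q.prob S) \<le> 2" by (simp add: algebra_simps)
    qed
    finally show ?thesis by simp
  qed
  have bm: "block m j \<in> measurable ?P ?Q" if "j < K" for j
    using measurable_block[OF that Km] by blast
  have ind: "P.indep_vars (\<lambda>_. borel) (\<lambda>j D. Z (block m j D)) {..<K}"
    by (rule P.indep_vars_compose2[OF indep_vars_blocks[OF M Km]]) simp
  have "(\<integral>\<^sup>+D. (\<Prod>j<K. Z (block m j D)) \<partial>?P) = (\<Prod>j<K. \<integral>\<^sup>+D. Z (block m j D) \<partial>?P)"
    using ind by (intro P.indep_vars_nn_integral) auto
  also have "\<dots> = (\<Prod>j<K. \<integral>\<^sup>+D. Z D \<partial>?Q)"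
  proof (intro prod.cong refl)
    fix j assume "j \<in> {..<K}"
    then have j: "j < K" by simp
    show "(\<integral>\<^sup>+D. Z (block m j D) \<partial>?P) = (\<integral>\<^sup>+D. Z D \<partial>?Q)"
      by (subst distr_block[OF M j Km, symmetric], subst nn_integral_distr[OF bm[OF j]]) simp_all
  qed
  also have "\<dots> \<le> 2 ^ K"
    using EZ by (simp add: power_mono)
  finally have E: "(\<integral>\<^sup>+D. (\<Prod>j<K. Z (block m j D)) \<partial>?P) \<le> 2 ^ K" .
  have Pm: "(\<lambda>D. \<Prod>j<K. Z (block m j D)) \<in> borel_measurable ?P"
      by (intro borel_measurable_prod_ennreal measurable_compose[OF bm Zm]) auto
  have "{D \<in> space ?P. 2 * card {j. j < K \<and> block m j D \<in> S} \<le> K}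
      \<subseteq> {D \<in> space ?P. 1 \<le> ennreal ((1/4) ^ K) * (\<Prod>j<K. Z (block m j D))}"
  proof safe
    fix D assume D: "2 * card {j. j < K \<and> block m j D \<in> S} \<le> K"
    let ?G = "{j. j < K \<and> block m j D \<in> S}"
    have "(\<Prod>j<K. Z (block m j D)) = (\<Prod>j\<in>{..<K} - ?G. Z (block m j D)) * (\<Prod>j\<in>?G. Z (block m j D))"
      by (rule prod.subset_diff) auto
    also have "\<dots> = 16 ^ card ({..<K} - ?G)"
      by (simp add: Z_def)
    also have "card ({..<K} - ?G) = K - card ?G"
      by (subst card_Diff_subset) auto
    \<comment> \<open>Writing 16 as the square of 4 doubles the exponent, so an odd \<open>K\<close>
      needs no rounding: twice the number of bad blocks is at least \<open>K\<close>.\<close>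
    also have "(16::ennreal) ^ (K - card ?G) = 4 ^ (2 * (K - card ?G))"
      by (simp add: power_mult)
    also have "\<dots> \<ge> 4 ^ K"
      using D by (intro power_increasing) auto
    finally have "4 ^ K \<le> (\<Prod>j<K. Z (block m j D))" .
    then have "ennreal ((1/4) ^ K) * 4 ^ K \<le> ennreal ((1/4) ^ K) * (\<Prod>j<K. Z (block m j D))"
      by (rule mult_left_mono) simp
    moreover have "ennreal ((1/4) ^ K) * 4 ^ K = 1"
    proof -
      have "(4::ennreal) ^ K = ennreal (4 ^ K)" by (simp add: ennreal_power[symmetric])
      then show ?thesis
        by (simp add: ennreal_mult[symmetric] power_mult_distrib[symmetric] del: power_divide)
    qed
    ultimately show "1 \<le> ennreal ((1/4) ^ K) * (\<Prod>j<K. Z (block m j D))" by simp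
  qed
  then have "emeasure ?P {D \<in> space ?P. 2 * card {j. j < K \<and> block m j D \<in> S} \<le> K}
    \<le> emeasure ?P {D \<in> space ?P. 1 \<le> ennreal ((1/4) ^ K) * (\<Prod>j<K. Z (block m j D))}"
    using Pm by (intro emeasure_mono) auto
  also have "\<dots> \<le> ennreal ((1/4) ^ K) * (\<integral>\<^sup>+D. (\<Prod>j<K. Z (block m j D)) * indicator (space ?P) D \<partial>?P)"
    using Pm by (intro nn_integral_Markov_inequality) auto
  also have "\<dots> \<le> ennreal ((1/4) ^ K) * 2 ^ K"
    using E by (intro mult_left_mono) (auto simp: nn_integral_cong[of ?P "\<lambda>D. (\<Prod>j<K. Z (block m j D)) * indicator (space ?P) D" "\<lambda>D. \<Prod>j<K. Z (block m j D)"])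
  also have "\<dots> = ennreal ((1/2) ^ K)"
  proof -
    have "(2::ennreal) ^ K = ennreal (2 ^ K)" by (simp add: ennreal_power[symmetric])
    moreover have "((1/4)::real) ^ K * 2 ^ K = (1/2) ^ K"
      by (simp add: power_mult_distrib[symmetric] del: power_divide)
    ultimately show ?thesis by (simp add: ennreal_mult[symmetric] del: power_divide)
  qed
  finally show ?thesis .
qed

section \<open>The laws of the model\<close>

lemma borel_measurable_vec_nth [measurable (raw)]:
  fixes f :: "'a \<Rightarrow> real^'n"
  assumes "f \<in> borel_measurable M"
  shows "(\<lambda>x. f x $ j) \<in> borel_measurable M"
  using assms by (rule measurable_compose) (intro borel_measurable_continuous_onI continuous_intros)

lemma mem_square_iff: "x \<in> square \<longleftrightarrow> (\<forall>j. \<bar>x $ j\<bar> \<le> 1)"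
  by (auto simp: square_def mem_box_cart abs_le_iff minus_le_iff)

lemma space_design_law [simp]: "space (design_law p) = square"
  by (simp add: design_law_def space_restrict_space)

lemma sets_design_law [measurable_cong]: "sets (design_law p) = sets (restrict_space borel square)"
  by (simp add: design_law_def) (rule sets_restrict_space_cong, simp)

lemma measurable_design_density:
  assumes "design_density p"
  shows "p \<in> borel_measurable (restrict_space lborel square)"
  using assms by (simp add: design_density_def measurable_cong_sets[OF sets_restrict_space_cong, of lborel borel])

lemma prob_space_design_law:
  assumes "design_density p"
  shows "prob_space (design_law p)"
proof (rule prob_spaceI)
  let ?R = "restrict_space lborel square"
  have "emeasure (design_law p) (space (design_law p)) = emeasure (density ?R (\<lambda>x. ennreal (p x))) (space ?R)"
    by (simp add: design_law_def)
  also have "\<dots> = (\<integral>\<^sup>+x. ennreal (p x) \<partial>?R)"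
    using measurable_design_density[OF assms]
    by (subst emeasure_density) (auto intro!: nn_integral_cong simp del: space_restrict_space)
  finally have "emeasure (design_law p) (space (design_law p)) = (\<integral>\<^sup>+x. ennreal (p x) \<partial>?R)" .
  then show "emeasure (design_law p) (space (design_law p)) = 1"
    using assms by (simp add: design_density_def)
qed

lemma space_noise_law [simp]: "space (noise_law \<sigma>) = UNIV"
  and sets_noise_law [measurable_cong, simp]: "sets (noise_law \<sigma>) = sets borel"
  by (simp_all add: noise_law_def)

text \<open>Tonelli for a product density: every coordinate other than \<open>j\<close> integrates
  to 1. The product over the index type is rewritten as one over \<open>Basis\<close>, the form in
  which Lebesgue measure on a Euclidean space factorises.\<close>

lemma nn_integral_noise_law_component:
  assumes "0 < \<sigma>" and [measurable]: "u \<in> borel_measurable borel"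
  shows "(\<integral>\<^sup>+e. u (e $ j) \<partial>noise_law \<sigma>) = (\<integral>\<^sup>+x. u x * ennreal (normal_density 0 \<sigma> x) \<partial>lborel)"
proof -
  let ?F = "\<lambda>b::real^2. \<lambda>x. ennreal (normal_density 0 \<sigma> x) * (if b = axis j 1 then u x else 1)"
  have B: "prod h (Basis::(real^2) set) = (\<Prod>i\<in>UNIV. h (axis i 1))" for h :: "real^2 \<Rightarrow> ennreal"
  proof -
    have bas: "(Basis::(real^2) set) = (\<lambda>i. axis i 1) ` UNIV" by (auto simp: Basis_vec_def)
    show ?thesis unfolding bas by (subst prod.reindex) (auto simp: inj_on_def axis_eq_axis)
  qed
  have eq: "axis i (1::real) = axis j 1 \<longleftrightarrow> i = j" for i by (simp add: axis_eq_axis)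
  have "(\<integral>\<^sup>+e. u (e $ j) \<partial>noise_law \<sigma>)
      = (\<integral>\<^sup>+e. ennreal (\<Prod>i\<in>UNIV. normal_density 0 \<sigma> (e $ i)) * u (e $ j) \<partial>lborel)"
    unfolding noise_law_def by (subst nn_integral_density) auto
  also have "\<dots> = (\<integral>\<^sup>+e. (\<Prod>b\<in>Basis. ?F b (e \<bullet> b)) \<partial>lborel)"
    unfolding B eq
    by (intro nn_integral_cong) (simp add: inner_axis prod.distrib prod_ennreal)
  also have "\<dots> = (\<Prod>b\<in>Basis. \<integral>\<^sup>+x. ?F b x \<partial>lborel)"
    by (intro nn_integral_lborel_prod) auto
  also have "\<dots> = (\<Prod>i\<in>UNIV. if i = j then \<integral>\<^sup>+x. u x * ennreal (normal_density 0 \<sigma> x) \<partial>lborel else 1)"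
    unfolding B eq
  proof (intro prod.cong refl)
    fix i :: 2
    have "(\<integral>\<^sup>+x. ennreal (normal_density 0 \<sigma> x) \<partial>lborel) = 1"
      using assms(1) by (subst nn_integral_eq_integral) (auto simp: integral_normal_density integrable_normal_density)
    then show "(\<integral>\<^sup>+x. ennreal (normal_density 0 \<sigma> x) * (if i = j then u x else 1) \<partial>lborel) =
        (if i = j then \<integral>\<^sup>+x. u x * ennreal (normal_density 0 \<sigma> x) \<partial>lborel else 1)"
      by (simp add: mult.commute)
  qed
  finally show ?thesis by simp
qed

lemma distr_noise_law_component:
  assumes "0 < \<sigma>"
  shows "distr (noise_law \<sigma>) borel (\<lambda>e. e $ j) = density lborel (\<lambda>x. ennreal (normal_density 0 \<sigma> x))"
proof (rule measure_eqI)
  fix A assume "A \<in> sets (distr (noise_law \<sigma>) borel (\<lambda>e. e $ j))"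
  then have [measurable]: "A \<in> sets borel" by simp
  have "emeasure (distr (noise_law \<sigma>) borel (\<lambda>e. e $ j)) A
      = (\<integral>\<^sup>+x. indicator A x \<partial>distr (noise_law \<sigma>) borel (\<lambda>e. e $ j))"
    by simp
  also have "\<dots> = (\<integral>\<^sup>+e. indicator A (e $ j) \<partial>noise_law \<sigma>)"
    by (subst nn_integral_distr) auto
  finally show "emeasure (distr (noise_law \<sigma>) borel (\<lambda>e. e $ j)) A
      = emeasure (density lborel (\<lambda>x. ennreal (normal_density 0 \<sigma> x))) A"
    using nn_integral_noise_law_component[OF assms, of "indicator A" j]
    by (simp add: emeasure_density mult.commute)
qed simp

lemma prob_space_noise_law:
  assumes "0 < \<sigma>"
  shows "prob_space (noise_law \<sigma>)"
proof (rule prob_spaceI)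
  interpret d: prob_space "density lborel (\<lambda>x. ennreal (normal_density 0 \<sigma> x))"
    using assms by (rule prob_space_normal_density)
  have "emeasure (noise_law \<sigma>) (space (noise_law \<sigma>)) = emeasure (distr (noise_law \<sigma>) borel (\<lambda>e. e $ 1)) UNIV"
    by (subst emeasure_distr) auto
  then show "emeasure (noise_law \<sigma>) (space (noise_law \<sigma>)) = 1"
    using d.emeasure_space_1 by (simp add: distr_noise_law_component[OF assms])
qed

lemma noise_law_moments:
  assumes "0 < \<sigma>"
  shows "integrable (noise_law \<sigma>) (\<lambda>e. e $ j)" "(\<integral>e. e $ j \<partial>noise_law \<sigma>) = 0"
    and "integrable (noise_law \<sigma>) (\<lambda>e. (e $ j)\<^sup>2)" "(\<integral>e. (e $ j)\<^sup>2 \<partial>noise_law \<sigma>) = \<sigma>\<^sup>2"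
proof -
  let ?d = "density lborel (\<lambda>x. ennreal (normal_density 0 \<sigma> x))"
  have eq: "integrable (noise_law \<sigma>) (\<lambda>e. h (e $ j)) \<longleftrightarrow> integrable lborel (\<lambda>x. normal_density 0 \<sigma> x * h x)"
       "(\<integral>e. h (e $ j) \<partial>noise_law \<sigma>) = (\<integral>x. normal_density 0 \<sigma> x * h x \<partial>lborel)"
     if [measurable]: "h \<in> borel_measurable borel" for h :: "real \<Rightarrow> real"
  proof -
    have "integrable (noise_law \<sigma>) (\<lambda>e. h (e $ j)) \<longleftrightarrow> integrable ?d h"
      by (subst distr_noise_law_component[OF assms, of j, symmetric], subst integrable_distr_eq) auto
    then show "integrable (noise_law \<sigma>) (\<lambda>e. h (e $ j)) \<longleftrightarrow> integrable lborel (\<lambda>x. normal_density 0 \<sigma> x * h x)"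
      by (simp add: integrable_density)
    have "(\<integral>e. h (e $ j) \<partial>noise_law \<sigma>) = (\<integral>x. h x \<partial>?d)"
      by (subst distr_noise_law_component[OF assms, of j, symmetric], subst integral_distr) auto
    then show "(\<integral>e. h (e $ j) \<partial>noise_law \<sigma>) = (\<integral>x. normal_density 0 \<sigma> x * h x \<partial>lborel)"
      by (simp add: integral_density)
  qed
  show "integrable (noise_law \<sigma>) (\<lambda>e. e $ j)" "(\<integral>e. e $ j \<partial>noise_law \<sigma>) = 0"
    using eq[of "\<lambda>x. x"] integrable_normal_moment_nz_1[OF assms, of 0] integral_normal_moment_nz_1[OF assms, of 0]
    by simp_all
  \<comment> \<open>This is the formula for even moments at order two, where
    \<open>fact 2 / (2 / \<sigma>\<^sup>2)\<close> reduces to the variance.\<close>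
  have "has_bochner_integral lborel (\<lambda>x. normal_density 0 \<sigma> x * (x - 0) ^ (2 * 1))
     (fact (2 * 1) / ((2 / \<sigma>\<^sup>2) ^ 1 * fact 1))"
    by (rule normal_moment_even[OF assms])
  then have "has_bochner_integral lborel (\<lambda>x. normal_density 0 \<sigma> x * x\<^sup>2) (\<sigma>\<^sup>2)"
    using assms by (simp add: fact_2)
  then show "integrable (noise_law \<sigma>) (\<lambda>e. (e $ j)\<^sup>2)" "(\<integral>e. (e $ j)\<^sup>2 \<partial>noise_law \<sigma>) = \<sigma>\<^sup>2"
    using eq[of "\<lambda>x. x\<^sup>2"] by (simp_all add: has_bochner_integral_iff)
qed

lemma measurable_obs_map:
  assumes [measurable]: "f \<in> borel_measurable (restrict_space borel square)"
  shows "(\<lambda>(x, e). (x, f x + e)) \<in> measurable (design_law p \<Otimes>\<^sub>M noise_law \<sigma>) obs_space"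
  unfolding obs_space_def by measurable

lemma sets_obs_law [measurable_cong, simp]: "sets (obs_law p \<sigma> f) = sets obs_space"
  and space_obs_law [simp]: "space (obs_law p \<sigma> f) = space obs_space"
  by (simp_all add: obs_law_def)

lemma prob_space_pair_design_noise:
  assumes "design_density p" "0 < \<sigma>"
  shows "prob_space (design_law p \<Otimes>\<^sub>M noise_law \<sigma>)"
proof -
  interpret d: prob_space "design_law p" using assms by (intro prob_space_design_law)
  interpret e: prob_space "noise_law \<sigma>" using assms by (intro prob_space_noise_law)
  interpret pair_prob_space "design_law p" "noise_law \<sigma>" ..
  show ?thesis by (rule prob_space_axioms)
qed

lemma prob_space_obs_law:
  assumes "design_density p" "0 < \<sigma>" "f \<in> borel_measurable (restrict_space borel square)"
  shows "prob_space (obs_law p \<sigma> f)"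
  unfolding obs_law_def
  using prob_space.prob_space_distr[OF prob_space_pair_design_noise[OF assms(1,2)] measurable_obs_map[OF assms(3)]] .

lemma sets_data_law [measurable_cong, simp]: "sets (data_law p \<sigma> n f) = sets (data_space n)"
  unfolding data_law_def data_space_def by (intro sets_PiM_cong) auto

lemma space_data_law [simp]: "space (data_law p \<sigma> n f) = space (data_space n)"
  by (rule sets_eq_imp_space_eq) simp

lemma prob_space_data_law:
  assumes "design_density p" "0 < \<sigma>" "f \<in> borel_measurable (restrict_space borel square)"
  shows "prob_space (data_law p \<sigma> n f)"
  unfolding data_law_def using prob_space_obs_law[OF assms] by (intro prob_space_PiM)

section \<open>Moments of one observation on a cell\<close>

lemma (in pair_sigma_finite) integral_product_mult:
  fixes u v :: "_ \<Rightarrow> real"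
  assumes u: "integrable M1 u" and v: "integrable M2 v"
  shows "integrable (M1 \<Otimes>\<^sub>M M2) (\<lambda>(x, y). u x * v y)"
    and "(\<integral>(x, y). u x * v y \<partial>(M1 \<Otimes>\<^sub>M M2)) = (\<integral>x. u x \<partial>M1) * (\<integral>y. v y \<partial>M2)"
proof -
  note [measurable] = borel_measurable_integrable[OF u] borel_measurable_integrable[OF v]
  show i: "integrable (M1 \<Otimes>\<^sub>M M2) (\<lambda>(x, y). u x * v y)"
    using u v by (intro Fubini_integrable) (auto simp: abs_mult)
  show "(\<integral>(x, y). u x * v y \<partial>(M1 \<Otimes>\<^sub>M M2)) = (\<integral>x. u x \<partial>M1) * (\<integral>y. v y \<partial>M2)"
    using integral_fst'[OF i] by simp
qed

text \<open>Under the model \<open>W\<close> is the sum of a design part with \<open>f x $ j\<close>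
  and a noise part with \<open>e $ j\<close>. The noise is centred and independent of the design, so
  the noise part drops out of the mean and the cross term out of the second moment; what remains of
  the latter is controlled by \<open>\<bar>f x $ j\<bar> \<le> 1\<close> and the noise variance. The
  factor \<open>measure (design_law p) A\<close> in the last bound later cancels the normalisation
  of the cell means.\<close>

lemma obs_law_cell_moments:
  fixes f :: "real^2 \<Rightarrow> real^2" and j :: 2
  assumes p: "design_density p" and \<sigma>: "0 < \<sigma>"
    and fm[measurable]: "f \<in> borel_measurable (restrict_space borel square)"
    and fb: "\<And>x. x \<in> square \<Longrightarrow> f x \<in> square"
    and A[measurable]: "A \<in> sets (restrict_space borel square)"
  defines "W \<equiv> \<lambda>z::(real^2) \<times> (real^2). indicat_real A (fst z) * snd z $ j"
  shows "integrable (obs_law p \<sigma> f) W"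
    and "(\<integral>z. W z \<partial>obs_law p \<sigma> f) = (\<integral>x. indicat_real A x * f x $ j \<partial>design_law p)"
    and "integrable (obs_law p \<sigma> f) (\<lambda>z. (W z)\<^sup>2)"
    and "(\<integral>z. (W z)\<^sup>2 \<partial>obs_law p \<sigma> f) \<le> (1 + \<sigma>\<^sup>2) * measure (design_law p) A"
proof -
  interpret d: prob_space "design_law p" using p by (intro prob_space_design_law)
  interpret e: prob_space "noise_law \<sigma>" using \<sigma> by (intro prob_space_noise_law)
  interpret pair_prob_space "design_law p" "noise_law \<sigma>" ..
  let ?PN = "design_law p \<Otimes>\<^sub>M noise_law \<sigma>" and ?I = "indicat_real A"
  let ?T = "\<lambda>z. (fst z, f (fst z) + snd z)"
  note noise = noise_law_moments[OF \<sigma>]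
  have Asq: "A \<inter> square = A"
    using sets.sets_into_space[OF A] by (auto simp: space_restrict_space)
  have Am[measurable]: "A \<in> sets (design_law p)" by (simp add: sets_design_law)
  have fj[measurable]: "(\<lambda>x. f x $ j) \<in> borel_measurable (design_law p)"
    unfolding measurable_cong_sets[OF sets_design_law refl] by (rule measurable_compose[OF fm]) measurable
  have Wm[measurable]: "W \<in> borel_measurable obs_space"
    unfolding W_def obs_space_def
    by measurable
  have T: "?T \<in> measurable ?PN obs_space"
    using measurable_obs_map[OF fm, of p \<sigma>] by (simp add: case_prod_unfold)
  have law: "obs_law p \<sigma> f = distr ?PN obs_space ?T"
    by (simp add: obs_law_def case_prod_unfold)
  have bound: "\<bar>?I x * (f x $ j) ^ k\<bar> \<le> ?I x" if "x \<in> square" for x k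
    using fb[OF that] by (auto simp: mem_square_iff indicator_def power_abs intro!: power_le_one)
  have iI: "integrable (design_law p) ?I"
    by (intro d.integrable_const_bound[where B=1]) (auto intro!: AE_I2 simp: indicator_def)
  have iu: "integrable (design_law p) (\<lambda>x. ?I x * (f x $ j) ^ k)" for k
    by (rule Bochner_Integration.integrable_bound[OF iI]) (use bound in \<open>auto intro!: AE_I2\<close>)
  have i1: "integrable (noise_law \<sigma>) (\<lambda>_. 1 :: real)" by simp
  note ip = integral_product_mult
  \<comment> \<open>The factors \<open>* 1\<close> and the power \<open>^ 1\<close> are kept on
    purpose: every summand has the form of a function of \<open>x\<close> times a function of
    \<open>e\<close>, to which the product formula applies.\<close>
  have WT: "W (?T z) = (\<lambda>(x, e). (?I x * (f x $ j) ^ 1) * 1) z + (\<lambda>(x, e). ?I x * e $ j) z" for z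
    by (simp add: W_def case_prod_unfold algebra_simps)
  have WT2: "(W (?T z))\<^sup>2 = (\<lambda>(x, e). (?I x * (f x $ j) ^ 2) * 1) z
      + (\<lambda>(x, e). (?I x * (f x $ j) ^ 1) * e $ j) z * 2 + (\<lambda>(x, e). ?I x * (e $ j)\<^sup>2) z" for z
    by (cases z) (auto simp: W_def indicator_def power2_eq_square algebra_simps)
  show "integrable (obs_law p \<sigma> f) W"
    unfolding law using ip(1)[OF iu[of 1] i1] ip(1)[OF iI noise(1)[of j]]
    by (subst integrable_distr_eq[OF T]) (auto simp only: WT Wm intro!: Bochner_Integration.integrable_add)
  show "(\<integral>z. W z \<partial>obs_law p \<sigma> f) = (\<integral>x. ?I x * f x $ j \<partial>design_law p)"
    unfolding law integral_distr[OF T Wm] WT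
    using ip[OF iu[of 1] i1] ip[OF iI noise(1)[of j]] noise(2)[of j]
    by (subst Bochner_Integration.integral_add) (auto simp: e.prob_space[simplified])
  have ints: "integrable ?PN (\<lambda>z. (\<lambda>(x, e). (?I x * (f x $ j) ^ 2) * 1) z)"
     "integrable ?PN (\<lambda>z. (\<lambda>(x, e). (?I x * (f x $ j) ^ 1) * e $ j) z * 2)"
     "integrable ?PN (\<lambda>z. (\<lambda>(x, e). ?I x * (e $ j)\<^sup>2) z)"
    using ip(1)[OF iu[of 2] i1] ip(1)[OF iu[of 1] noise(1)[of j]] ip(1)[OF iI noise(3)[of j]]
    by (auto simp only: intro!: integrable_mult_left)
  show "integrable (obs_law p \<sigma> f) (\<lambda>z. (W z)\<^sup>2)"
    unfolding law using ints
    by (subst integrable_distr_eq[OF T]) (auto simp only: WT2 intro!: Bochner_Integration.integrable_add borel_measurable_power Wm)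
  have "(\<integral>z. (W z)\<^sup>2 \<partial>obs_law p \<sigma> f) = (\<integral>z. (W (?T z))\<^sup>2 \<partial>?PN)"
    unfolding law by (rule integral_distr[OF T]) measurable
  also have "\<dots> = (\<integral>x. ?I x * (f x $ j)\<^sup>2 \<partial>design_law p) + \<sigma>\<^sup>2 * measure (design_law p) A"
    unfolding WT2
    using ip(2)[OF iu[of 2] i1] ip(2)[OF iu[of 1] noise(1)[of j]] ip(2)[OF iI noise(3)[of j]] noise(2,4)[of j] ints
    by (simp add: e.prob_space[simplified] Asq)
  also have "(\<integral>x. ?I x * (f x $ j)\<^sup>2 \<partial>design_law p) \<le> (\<integral>x. ?I x \<partial>design_law p)"
    using iu[of 2] iI bound[of _ 2] by (intro integral_mono) (auto simp: abs_le_iff Asq)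
  finally show "(\<integral>z. (W z)\<^sup>2 \<partial>obs_law p \<sigma> f) \<le> (1 + \<sigma>\<^sup>2) * measure (design_law p) A"
    by (simp add: algebra_simps Asq)
qed

section \<open>The histogram estimator\<close>

lemma power2_add_le: "(a + b)\<^sup>2 \<le> 2 * a\<^sup>2 + 2 * b\<^sup>2" for a b :: real
  using zero_le_power2[of "a - b"] by (simp add: power2_eq_square algebra_simps)

definition cell_mean :: "(real^2 \<Rightarrow> real) \<Rightarrow> nat \<Rightarrow> (real^2) set \<Rightarrow> data \<Rightarrow> 2 \<Rightarrow> real" where
  "cell_mean p n A D j =
     (\<Sum>i<n. indicat_real A (fst (D i)) * snd (D i) $ j) / real n / measure (design_law p) A"

text \<open>
  The design law is known, so the denominators of the histogram are the exact probabilities of the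
  cells; this makes the cell means unbiased.
\<close>
definition histogram :: "(real^2 \<Rightarrow> real) \<Rightarrow> nat \<Rightarrow> (real^2) set set \<Rightarrow> estimator" where
  "histogram p n \<A> D x = (\<chi> j. \<Sum>A\<in>\<A>. indicat_real A x * cell_mean p n A D j)"

definition cell_partition :: "real \<Rightarrow> (real^2) set set \<Rightarrow> bool" where
  "cell_partition d \<A> \<longleftrightarrow> finite \<A> \<and> disjoint \<A> \<and> \<Union>\<A> = square \<and>
     \<A> \<subseteq> sets (restrict_space borel square) \<and> (\<forall>A\<in>\<A>. \<forall>x\<in>A. \<forall>x'\<in>A. norm (x - x') \<le> d)"

lemma histogram_eq:
  assumes "cell_partition d \<A>" "A \<in> \<A>" "x \<in> A"
  shows "histogram p n \<A> D x $ j = cell_mean p n A D j"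
proof -
  have "x \<in> B \<longleftrightarrow> B = A" if "B \<in> \<A>" for B
    using assms that unfolding cell_partition_def disjoint_def by blast
  then have "histogram p n \<A> D x $ j = (\<Sum>B\<in>\<A>. if B = A then cell_mean p n B D j else 0)"
    unfolding histogram_def by (auto intro!: sum.cong simp: indicator_def)
  then show ?thesis using assms by (simp add: cell_partition_def)
qed

lemma measurable_cell_mean:
  assumes [measurable]: "A \<in> sets (restrict_space borel square)"
  shows "(\<lambda>D. cell_mean p n A D j) \<in> borel_measurable (data_space n)"
proof -
  have [measurable]: "(\<lambda>D. indicat_real A (fst (D i)) * snd (D i) $ j) \<in> borel_measurable (data_space n)"
    if "i < n" for i
  proof -
    have "(\<lambda>D. D i) \<in> measurable (data_space n) obs_space"
      using that unfolding data_space_def by (intro measurable_component_singleton) simp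
    moreover have "(\<lambda>z. indicat_real A (fst z) * snd z $ j) \<in> borel_measurable obs_space"
      unfolding obs_space_def by measurable
    ultimately show ?thesis by (rule measurable_compose)
  qed
  show ?thesis unfolding cell_mean_def
    by (intro borel_measurable_divide borel_measurable_sum) auto
qed

lemma measurable_histogram:
  assumes "cell_partition d \<A>"
  shows "(\<lambda>(D, x). histogram p n \<A> D x $ j) \<in> borel_measurable (data_space n \<Otimes>\<^sub>M restrict_space borel square)"
proof -
  have "(\<lambda>z. indicat_real A (snd z) * cell_mean p n A (fst z) j)
      \<in> borel_measurable (data_space n \<Otimes>\<^sub>M restrict_space borel square)" if "A \<in> \<A>" for A
  proof -
    have A[measurable]: "A \<in> sets (restrict_space borel square)"
      using assms that by (auto simp: cell_partition_def)
    note [measurable] = measurable_cell_mean[OF A, of p n j]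
    show ?thesis by measurable
  qed
  then show ?thesis
    unfolding histogram_def case_prod_unfold by simp
qed

text \<open>A bias-variance split that is valid for every single data set. On a cell
  \<open>A\<close>, the error is the sum of \<open>cell_mean p n A D j - c A\<close>, constant on
  the cell, and of \<open>c A - f x $ j\<close>. As \<open>c A\<close> averages \<open>f $ j\<close>
  over the cell, the second part is at most the oscillation \<open>L * d\<close>. Randomness enters
  only through the first part.\<close>

lemma nn_integral_histogram_error_le:
  fixes f :: "real^2 \<Rightarrow> real^2" and j :: 2
  assumes p: "design_density p"
    and fm: "f \<in> borel_measurable (restrict_space borel square)"
    and fb: "\<And>x. x \<in> square \<Longrightarrow> f x \<in> square"
    and fL: "\<And>x x'. x \<in> square \<Longrightarrow> x' \<in> square \<Longrightarrow> norm (f x - f x') \<le> L * norm (x - x')"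
    and L: "0 \<le> L" and \<A>: "cell_partition d \<A>"
  defines "c \<equiv> \<lambda>A. (\<integral>x. indicat_real A x * f x $ j \<partial>design_law p) / measure (design_law p) A"
  shows "(\<integral>\<^sup>+x. ennreal ((histogram p n \<A> D x $ j - f x $ j)\<^sup>2) \<partial>design_law p)
     \<le> (\<Sum>A\<in>\<A>. ennreal (2 * (cell_mean p n A D j - c A)\<^sup>2 * measure (design_law p) A)) + ennreal (2 * (L * d)\<^sup>2)"
proof -
  let ?P = "design_law p"
  interpret P: prob_space ?P using p by (rule prob_space_design_law)
  have fin: "finite \<A>" and disj: "disjoint \<A>" and un: "\<Union>\<A> = square"
    and dd: "\<And>A x x'. A \<in> \<A> \<Longrightarrow> x \<in> A \<Longrightarrow> x' \<in> A \<Longrightarrow> norm (x - x') \<le> d"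
    using \<A> by (auto simp: cell_partition_def)
  have Am[measurable]: "A \<in> sets ?P" if "A \<in> \<A>" for A
    using \<A> that by (auto simp: cell_partition_def sets_design_law)
  have Asub: "A \<subseteq> square" if "A \<in> \<A>" for A using un that by auto
  have fj[measurable]: "(\<lambda>x. f x $ j) \<in> borel_measurable ?P"
    unfolding measurable_cong_sets[OF sets_design_law refl] using fm by measurable
  have osc: "\<bar>f x' $ j - f x $ j\<bar> \<le> L * d" if "A \<in> \<A>" "x \<in> A" "x' \<in> A" for A x x'
  proof -
    have "\<bar>f x' $ j - f x $ j\<bar> \<le> norm (f x' - f x)"
      using component_le_norm_cart[of "f x' - f x" j] by simp
    also have "\<dots> \<le> L * norm (x' - x)" using that Asub by (intro fL) auto
    also have "\<dots> \<le> L * d" using that L dd by (intro mult_left_mono) auto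
    finally show ?thesis .
  qed
  have int: "integrable ?P (\<lambda>x. indicat_real A x * f x $ j)" if "A \<in> \<A>" for A
    using that fb by (intro P.integrable_const_bound[where B=1])
      (auto intro!: AE_I2 simp: indicator_def mem_square_iff)
  have bias: "\<bar>c A - f x $ j\<bar> \<le> L * d" if A: "A \<in> \<A>" "x \<in> A" and pos: "0 < P.prob A" for A x
  proof -
    have iA: "integrable ?P (indicat_real A)"
      using A by (intro P.integrable_const_bound[where B=1]) (auto intro!: AE_I2 simp: indicator_def)
    have Ai: "A \<inter> square = A" using Asub[OF A(1)] by auto
    have "(c A - f x $ j) * P.prob A = (\<integral>x'. indicat_real A x' * f x' $ j \<partial>?P) - (\<integral>x'. indicat_real A x' * f x $ j \<partial>?P)"
      using pos by (simp add: c_def Ai field_simps)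
    also have "\<dots> = (\<integral>x'. indicat_real A x' * (f x' $ j - f x $ j) \<partial>?P)"
      using int[OF A(1)] iA by (subst Bochner_Integration.integral_diff[symmetric]) (auto simp: algebra_simps)
    finally have "\<bar>(c A - f x $ j) * P.prob A\<bar> \<le> (\<integral>x'. \<bar>indicat_real A x' * (f x' $ j - f x $ j)\<bar> \<partial>?P)"
      using integral_abs_bound by simp
    also have "\<dots> \<le> (\<integral>x'. L * d * indicat_real A x' \<partial>?P)"
    proof (rule integral_mono')
      show "integrable ?P (\<lambda>x'. L * d * indicat_real A x')" using iA by simp
      show "\<bar>indicat_real A x' * (f x' $ j - f x $ j)\<bar> \<le> L * d * indicat_real A x'" for x'
        using osc[OF A, of x'] by (simp add: indicator_def)
      have "0 \<le> L * d" using osc[OF A A(2)] by simp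
      then show "0 \<le> L * d * indicat_real A x'" for x' by simp
    qed
    also have "\<dots> = L * d * P.prob A" by (simp add: Ai)
    finally show ?thesis using pos by (simp add: abs_mult)
  qed
  have cellbd: "(\<integral>\<^sup>+x. ennreal ((cell_mean p n A D j - f x $ j)\<^sup>2) * indicator A x \<partial>?P)
      \<le> ennreal (2 * (cell_mean p n A D j - c A)\<^sup>2 * P.prob A) + ennreal (2 * (L * d)\<^sup>2) * emeasure ?P A"
    if A: "A \<in> \<A>" for A
  proof (cases "P.prob A = 0")
    \<comment> \<open>Division by zero makes the mean of such a cell 0, possibly far from
      \<open>f\<close>, but the cell is a null set of the design.\<close>
    case True
    then have "A \<in> null_sets ?P" using A by (auto simp: P.emeasure_eq_measure null_sets_def)
    then show ?thesis by (simp add: nn_integral_null_set)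
  next
    case False
    then have pos: "0 < P.prob A" using zero_less_measure_iff by blast
    let ?e = "cell_mean p n A D j - c A"
    have "(\<integral>\<^sup>+x. ennreal ((cell_mean p n A D j - f x $ j)\<^sup>2) * indicator A x \<partial>?P)
        \<le> (\<integral>\<^sup>+x. ennreal (2 * ?e\<^sup>2 + 2 * (L * d)\<^sup>2) * indicator A x \<partial>?P)"
    proof (intro nn_integral_mono)
      fix x
      show "ennreal ((cell_mean p n A D j - f x $ j)\<^sup>2) * indicator A x
          \<le> ennreal (2 * ?e\<^sup>2 + 2 * (L * d)\<^sup>2) * indicator A x"
      proof (cases "x \<in> A")
        case True
        let ?g = "c A - f x $ j"
        have "(cell_mean p n A D j - f x $ j)\<^sup>2 = (?e + ?g)\<^sup>2" by simp
        also have "\<dots> \<le> 2 * ?e\<^sup>2 + 2 * ?g\<^sup>2" by (rule power2_add_le)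
        also have "?g\<^sup>2 \<le> (L * d)\<^sup>2"
          using bias[OF A True pos] by (metis abs_ge_zero power2_abs power_mono)
        finally show ?thesis by (intro mult_right_mono ennreal_leI) auto
      qed simp
    qed
    also have "\<dots> = ennreal (2 * ?e\<^sup>2 + 2 * (L * d)\<^sup>2) * emeasure ?P A"
      using A by (simp add: nn_integral_cmult)
    also have "\<dots> = ennreal (2 * ?e\<^sup>2 * P.prob A) + ennreal (2 * (L * d)\<^sup>2) * emeasure ?P A"
      by (simp add: P.emeasure_eq_measure distrib_right ennreal_mult'')
    finally show ?thesis .
  qed
  have "(\<integral>\<^sup>+x. ennreal ((histogram p n \<A> D x $ j - f x $ j)\<^sup>2) \<partial>?P)
      = (\<integral>\<^sup>+x. (\<Sum>A\<in>\<A>. ennreal ((cell_mean p n A D j - f x $ j)\<^sup>2) * indicator A x) \<partial>?P)"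
  proof (intro nn_integral_cong)
    fix x assume "x \<in> space ?P"
    then obtain B where B: "B \<in> \<A>" "x \<in> B" using un by auto
    have "x \<in> A \<longleftrightarrow> A = B" if "A \<in> \<A>" for A
      using B that disj by (auto simp: disjoint_def)
    then have "(\<Sum>A\<in>\<A>. ennreal ((cell_mean p n A D j - f x $ j)\<^sup>2) * indicator A x)
        = (\<Sum>A\<in>\<A>. if A = B then ennreal ((cell_mean p n A D j - f x $ j)\<^sup>2) else 0)"
      by (intro sum.cong) (auto simp: indicator_def)
    then show "ennreal ((histogram p n \<A> D x $ j - f x $ j)\<^sup>2)
        = (\<Sum>A\<in>\<A>. ennreal ((cell_mean p n A D j - f x $ j)\<^sup>2) * indicator A x)"
      using B fin by (simp add: histogram_eq[OF \<A> B])
  qed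
  also have "\<dots> = (\<Sum>A\<in>\<A>. \<integral>\<^sup>+x. ennreal ((cell_mean p n A D j - f x $ j)\<^sup>2) * indicator A x \<partial>?P)"
    by (intro nn_integral_sum) auto
  also have "\<dots> \<le> (\<Sum>A\<in>\<A>. ennreal (2 * (cell_mean p n A D j - c A)\<^sup>2 * P.prob A) + ennreal (2 * (L * d)\<^sup>2) * emeasure ?P A)"
    by (intro sum_mono cellbd)
  also have "\<dots> = (\<Sum>A\<in>\<A>. ennreal (2 * (cell_mean p n A D j - c A)\<^sup>2 * P.prob A)) + ennreal (2 * (L * d)\<^sup>2) * (\<Sum>A\<in>\<A>. emeasure ?P A)"
    by (simp add: sum.distrib sum_distrib_left)
  also have "(\<Sum>A\<in>\<A>. emeasure ?P A) = emeasure ?P (\<Union>A\<in>\<A>. A)"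
    using fin disj by (intro sum_emeasure) (auto simp: disjoint_family_on_def disjoint_def)
  also have "\<dots> = 1" using un P.emeasure_space_1 by simp
  finally show ?thesis by simp
qed

text \<open>The variance of the unnormalised cell average is at most
  \<open>(1 + \<sigma>\<^sup>2)\<close> times the cell probability over \<open>n\<close>.
  Normalising divides by the squared probability, and the weight of the cell in the integral
  multiplies by it once. So every cell contributes at most
  \<open>2 * (1 + \<sigma>\<^sup>2) / n\<close>, whatever its probability, and only the number of
  cells matters.\<close>

lemma histogram_risk_le:
  fixes f :: "real^2 \<Rightarrow> real^2" and j :: 2
  assumes p: "design_density p" and \<sigma>: "0 < \<sigma>" and n: "0 < n"
    and fm: "f \<in> borel_measurable (restrict_space borel square)"
    and fb: "\<And>x. x \<in> square \<Longrightarrow> f x \<in> square"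
    and fL: "\<And>x x'. x \<in> square \<Longrightarrow> x' \<in> square \<Longrightarrow> norm (f x - f x') \<le> L * norm (x - x')"
    and L: "0 \<le> L" and \<A>: "cell_partition d \<A>"
  shows "(\<integral>\<^sup>+D. \<integral>\<^sup>+x. ennreal ((histogram p n \<A> D x $ j - f x $ j)\<^sup>2) \<partial>design_law p \<partial>data_law p \<sigma> n f)
     \<le> ennreal (real (card \<A>) * (2 * (1 + \<sigma>\<^sup>2)) / n + 2 * (L * d)\<^sup>2)"
proof -
  let ?P = "design_law p" and ?Q = "data_law p \<sigma> n f"
  interpret P: prob_space ?P using p by (rule prob_space_design_law)
  interpret Q: prob_space ?Q using p \<sigma> fm by (rule prob_space_data_law)
  define c where "c A = (\<integral>x. indicat_real A x * f x $ j \<partial>?P) / P.prob A" for A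
  let ?t = "\<lambda>A D. ennreal (2 * (cell_mean p n A D j - c A)\<^sup>2 * P.prob A)"
  have Am: "A \<in> sets (restrict_space borel square)" if "A \<in> \<A>" for A
    using \<A> that by (auto simp: cell_partition_def)
  have tm: "?t A \<in> borel_measurable ?Q" if "A \<in> \<A>" for A
    unfolding measurable_cong_sets[OF sets_data_law refl]
    using measurable_cell_mean[OF Am[OF that], of p n j] by measurable
  have t: "(\<integral>\<^sup>+D. ?t A D \<partial>?Q) \<le> ennreal (2 * (1 + \<sigma>\<^sup>2) / n)" if A: "A \<in> \<A>" for A
  proof (cases "P.prob A = 0")
    case False
    then have pos: "0 < P.prob A" using zero_less_measure_iff by blast
    let ?W = "\<lambda>z::(real^2) \<times> (real^2). indicat_real A (fst z) * snd z $ j"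
    note mom = obs_law_cell_moments[OF p \<sigma> fm fb Am[OF A], of j]
    let ?w = "\<integral>z. ?W z \<partial>obs_law p \<sigma> f"
    have cA: "c A = ?w / P.prob A" by (simp only: c_def mom(2))
    have Wm: "?W \<in> borel_measurable obs_space"
      unfolding obs_space_def using Am[OF A] by measurable
    have "?t A D = ennreal (2 / P.prob A) * ennreal (((\<Sum>i<n. ?W (D i)) / real n - ?w)\<^sup>2)" for D
    proof -
      have "2 * (cell_mean p n A D j - c A)\<^sup>2 * P.prob A = 2 / P.prob A * ((\<Sum>i<n. ?W (D i)) / real n - ?w)\<^sup>2"
        using pos unfolding cell_mean_def cA diff_divide_distrib[symmetric] power_divide
        by (simp add: power2_eq_square)
      then show ?thesis using pos by (simp only:) (rule ennreal_mult, auto)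
    qed
    moreover have "(\<lambda>D. ennreal (((\<Sum>i<n. ?W (D i)) / real n - ?w)\<^sup>2)) \<in> borel_measurable ?Q"
    proof -
      have "(\<lambda>D. ?W (D i)) \<in> borel_measurable ?Q" if "i < n" for i
        unfolding measurable_cong_sets[OF sets_data_law refl] data_space_def
        by (rule measurable_compose[OF _ Wm]) (use that in \<open>intro measurable_component_singleton, simp\<close>)
      then show ?thesis by measurable
    qed
    ultimately have "(\<integral>\<^sup>+D. ?t A D \<partial>?Q) = ennreal (2 / P.prob A) * (\<integral>\<^sup>+D. ennreal (((\<Sum>i<n. ?W (D i)) / real n - ?w)\<^sup>2) \<partial>?Q)"
      by (simp add: nn_integral_cmult)
    also have "\<dots> \<le> ennreal (2 / P.prob A) * ennreal ((1 + \<sigma>\<^sup>2) * P.prob A / n)"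
    proof (intro mult_left_mono order_trans[OF mean_square_error_iid[OF prob_space_obs_law[OF p \<sigma> fm] mom(1,3) n, folded data_law_def]])
      show "ennreal ((\<integral>z. (?W z)\<^sup>2 \<partial>obs_law p \<sigma> f) / real n) \<le> ennreal ((1 + \<sigma>\<^sup>2) * P.prob A / n)"
        using mom(4) by (intro ennreal_leI divide_right_mono) auto
    qed auto
    also have "\<dots> = ennreal (2 * (1 + \<sigma>\<^sup>2) / n)"
      using pos by (simp add: ennreal_mult'[symmetric])
    finally show ?thesis .
  qed simp
  have "(\<integral>\<^sup>+D. \<integral>\<^sup>+x. ennreal ((histogram p n \<A> D x $ j - f x $ j)\<^sup>2) \<partial>?P \<partial>?Q)
     \<le> (\<integral>\<^sup>+D. (\<Sum>A\<in>\<A>. ?t A D) + ennreal (2 * (L * d)\<^sup>2) \<partial>?Q)"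
    unfolding c_def by (intro nn_integral_mono nn_integral_histogram_error_le[OF p fm fb fL L \<A>])
  also have "\<dots> = (\<Sum>A\<in>\<A>. \<integral>\<^sup>+D. ?t A D \<partial>?Q) + ennreal (2 * (L * d)\<^sup>2)"
  proof -
    have "(\<integral>\<^sup>+D. (\<Sum>A\<in>\<A>. ?t A D) \<partial>?Q) = (\<Sum>A\<in>\<A>. \<integral>\<^sup>+D. ?t A D \<partial>?Q)"
      by (rule nn_integral_sum) (rule tm)
    moreover have "(\<lambda>D. \<Sum>A\<in>\<A>. ?t A D) \<in> borel_measurable ?Q"
      by (rule borel_measurable_sum) (rule tm)
    ultimately show ?thesis
      by (subst nn_integral_add) (auto simp: Q.emeasure_space_1[simplified])
  qed
  also have "\<dots> \<le> (\<Sum>A\<in>\<A>. ennreal (2 * (1 + \<sigma>\<^sup>2) / n)) + ennreal (2 * (L * d)\<^sup>2)"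
    by (intro add_mono sum_mono t) auto
  also have "\<dots> = ennreal (real (card \<A>) * (2 * (1 + \<sigma>\<^sup>2)) / n + 2 * (L * d)\<^sup>2)"
    by (simp add: ennreal_of_nat_eq_real_of_nat ennreal_mult'[symmetric])
  finally show ?thesis .
qed

section \<open>Invertible bi-Lipschitz maps\<close>

lemma cell_partition_grid:
  assumes "0 < (k::nat)"
  obtains \<A> where "cell_partition (2 / k) \<A>" "card \<A> \<le> 9 * k\<^sup>2"
proof
  let ?q = "\<lambda>x::real^2. (\<lfloor>real k * x $ 1\<rfloor>, \<lfloor>real k * x $ 2\<rfloor>)"
  \<comment> \<open>The label \<open>k\<close> occurs only for coordinate 1, at the boundary; this
    makes \<open>2 * k + 1\<close> labels per axis, at most \<open>3 * k\<close>. The diameter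
    \<open>2 / k\<close> is the sum of two coordinate differences of at most
    \<open>1 / k\<close>.\<close>
  let ?R = "{- int k..int k}"
  define \<A> where "\<A> = (\<lambda>a. {x \<in> square. ?q x = a}) ` (?R \<times> ?R)"
  have range: "\<lfloor>real k * x $ j\<rfloor> \<in> ?R" if "x \<in> square" for x :: "real^2" and j
  proof -
    have "\<bar>real k * x $ j\<bar> \<le> real k" using that by (simp add: mem_square_iff abs_mult mult_left_le)
    then show ?thesis by (simp add: le_floor_iff floor_le_iff abs_le_iff)
  qed
  have close: "\<bar>s - t\<bar> \<le> 1 / real k" if "\<lfloor>real k * s\<rfloor> = \<lfloor>real k * t\<rfloor>" for s t
  proof -
    have "\<bar>real k * s - real k * t\<bar> \<le> 1" using that by linarith
    then have "real k * \<bar>s - t\<bar> \<le> 1" by (simp add: right_diff_distrib[symmetric] abs_mult)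
    then show ?thesis using assms by (simp add: field_simps)
  qed
  have sq: "square \<in> sets borel" by (simp add: square_def)
  have "{x \<in> square. ?q x = a} \<in> sets (restrict_space borel square)" for a
  proof -
    have "{x \<in> space borel. ?q x = a} \<in> sets borel" by (cases a) (simp, measurable)
    then have "square \<inter> {x. ?q x = a} \<in> sets borel" using sq by auto
    then show ?thesis using sq by (subst sets_restrict_space_iff) (auto simp: Int_def)
  qed
  moreover have "norm (x - x') \<le> 2 / real k" if "?q x = ?q x'" for x x' :: "real^2"
  proof -
    have "norm (x - x') \<le> (\<Sum>j\<in>UNIV. \<bar>(x - x') $ j\<bar>)" by (rule norm_le_l1_cart)
    also have "\<dots> \<le> 1 / real k + 1 / real k"
      using close[of "x $ 1" "x' $ 1"] close[of "x $ 2" "x' $ 2"] that by (simp add: sum_2)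
    finally show ?thesis by simp
  qed
  moreover have "\<Union>\<A> = square" using range by (fastforce simp: \<A>_def)
  ultimately show "cell_partition (2 / k) \<A>"
    unfolding cell_partition_def by (auto simp: \<A>_def disjoint_def)
  have "card \<A> \<le> card (?R \<times> ?R)" unfolding \<A>_def by (intro card_image_le) auto
  also have "\<dots> = (2 * k + 1)\<^sup>2" by (simp add: power2_eq_square nat_add_distrib nat_mult_distrib)
  also have "\<dots> \<le> (3 * k)\<^sup>2" using assms by (intro power_mono) auto
  finally show "card \<A> \<le> 9 * k\<^sup>2" by (simp add: power_mult_distrib)
qed

lemma finite_dense_square:
  assumes "0 < \<epsilon>"
  obtains T where "finite T" "T \<subseteq> square" "\<And>x. x \<in> square \<Longrightarrow> \<exists>t\<in>T. norm (x - t) \<le> \<epsilon>"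
proof -
  have "seq_compact square" by (simp add: square_def compact_imp_seq_compact)
  from seq_compact_imp_totally_bounded[OF this] assms
  obtain T where T: "finite T" "T \<subseteq> square" "square \<subseteq> (\<Union>t\<in>T. ball t \<epsilon>)"
    by meson
  show thesis
  proof (rule that[OF T(1,2)])
    fix x assume "x \<in> square"
    then obtain t where "t \<in> T" "dist t x < \<epsilon>" using T(3) by auto
    then show "\<exists>t\<in>T. norm (x - t) \<le> \<epsilon>"
      by (intro bexI[of _ t]) (simp_all add: dist_norm norm_minus_commute)
  qed
qed

text \<open>Round the values of \<open>f\<close> on a finite set \<open>T\<close> to a finite set
  \<open>V\<close>: only finitely many codes arise, and two functions with the same code are
  uniformly close. One function of \<open>F\<close> is chosen per code, so the net lies inside
  \<open>F\<close>; this is what makes the later estimator invertible. The error is four quarters of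
  \<open>\<epsilon>\<close>: one Lipschitz step from \<open>x\<close> to \<open>T\<close> and one
  rounding, for each of the two functions.\<close>

lemma finite_uniform_net:
  fixes F :: "(real^2 \<Rightarrow> real^2) set"
  assumes "0 < \<epsilon>" and L: "0 < L"
    and F: "\<And>f x. f \<in> F \<Longrightarrow> x \<in> square \<Longrightarrow> f x \<in> square"
    and FL: "\<And>f x x'. f \<in> F \<Longrightarrow> x \<in> square \<Longrightarrow> x' \<in> square \<Longrightarrow> norm (f x - f x') \<le> L * norm (x - x')"
  shows "\<exists>G\<subseteq>F. finite G \<and> (\<forall>f\<in>F. \<exists>g\<in>G. \<forall>x\<in>square. norm (f x - g x) \<le> \<epsilon>)"
proof -
  obtain T where T: "finite T" "T \<subseteq> square" "\<And>x. x \<in> square \<Longrightarrow> \<exists>t\<in>T. norm (x - t) \<le> \<epsilon> / (4 * L)"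
    by (rule finite_dense_square[of "\<epsilon> / (4 * L)"]) (use assms(1) L in simp_all)
  obtain V where V: "finite V" "\<And>x. x \<in> square \<Longrightarrow> \<exists>v\<in>V. norm (x - v) \<le> \<epsilon> / 4"
    by (rule finite_dense_square[of "\<epsilon> / 4"]) (use assms(1) in simp_all)
  define code where "code f = (\<lambda>t\<in>T. SOME v. v \<in> V \<and> norm (f t - v) \<le> \<epsilon> / 4)" for f :: "real^2 \<Rightarrow> real^2"
  have code: "code f t \<in> V \<and> norm (f t - code f t) \<le> \<epsilon> / 4" if "f \<in> F" "t \<in> T" for f t
  proof -
    have "\<exists>v. v \<in> V \<and> norm (f t - v) \<le> \<epsilon> / 4" using V(2)[OF F[OF that(1) subsetD[OF T(2) that(2)]]] by blast
    from someI_ex[OF this] show ?thesis using that by (simp add: code_def)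
  qed
  define G where "G = inv_into F code ` code ` F"
  have "code f \<in> T \<rightarrow>\<^sub>E V" if "f \<in> F" for f
    using code[OF that] by (intro PiE_I) (simp, simp add: code_def)
  then have "code ` F \<subseteq> T \<rightarrow>\<^sub>E V" by blast
  then have "finite (code ` F)" using finite_subset[OF _ finite_PiE[OF T(1), of "\<lambda>_. V"]] V(1) by simp
  then have "finite G" by (simp add: G_def)
  moreover have "G \<subseteq> F" by (auto simp: G_def inv_into_into)
  moreover have "\<exists>g\<in>G. \<forall>x\<in>square. norm (f x - g x) \<le> \<epsilon>" if f: "f \<in> F" for f
  proof (intro bexI ballI)
    let ?g = "inv_into F code (code f)"
    show "?g \<in> G" using f by (auto simp: G_def)
    then have g: "?g \<in> F" using \<open>G \<subseteq> F\<close> by auto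
    have tri: "norm (a + b - c - d) \<le> norm a + norm b + norm c + norm d" for a b c d :: "real^2"
      using norm_triangle_ineq4[of "a + b - c" d] norm_triangle_ineq4[of "a + b" c] norm_triangle_ineq[of a b]
      by linarith
    have cg: "code ?g = code f" using f by (simp add: f_inv_into_f)
    fix x assume x: "x \<in> square"
    then obtain t where t: "t \<in> T" "norm (x - t) \<le> \<epsilon> / (4 * L)" using T(3) by blast
    have lip: "norm (h x - h t) \<le> \<epsilon> / 4" if "h \<in> F" for h
    proof -
      have "norm (h x - h t) \<le> L * norm (x - t)" using FL[OF that x subsetD[OF T(2) t(1)]] .
      also have "\<dots> \<le> L * (\<epsilon> / (4 * L))" using t L by (intro mult_left_mono) auto
      finally show ?thesis using L by simp
    qed
    have "norm (f x - ?g x) \<le> norm (f x - f t) + norm (f t - code f t) + norm (?g t - code f t) + norm (?g x - ?g t)"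
      using tri[of "f x - f t" "f t - code f t" "?g t - code f t" "?g x - ?g t"] by simp
    also have "\<dots> \<le> \<epsilon> / 4 + \<epsilon> / 4 + \<epsilon> / 4 + \<epsilon> / 4"
      using lip[OF f] lip[OF g] code[OF f t(1)] code[OF g t(1)] cg by (intro add_mono) auto
    finally show "norm (f x - ?g x) \<le> \<epsilon>" by simp
  qed
  ultimately show ?thesis by blast
qed

section \<open>Members of the class and their inverses\<close>

lemma F_INV_Lip_in_square: "f \<in> F_INV_Lip \<Lambda> \<Longrightarrow> x \<in> square \<Longrightarrow> f x \<in> square"
  by (auto simp: F_INV_Lip_def)

lemma F_INV_Lip_bi_Lipschitz:
  assumes "f \<in> F_INV_Lip (ereal L)"
  shows "bi_Lipschitz_on L square f"
proof -
  obtain L' where L': "1 \<le> L'" "L' \<le> L" "bi_Lipschitz_on L' square f"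
    using assms by (auto simp: F_INV_Lip_def)
  show ?thesis unfolding bi_Lipschitz_on_def
  proof (intro ballI conjI)
    fix x x' assume x: "x \<in> square" "x' \<in> square"
    have "inverse L * norm (x - x') \<le> inverse L' * norm (x - x')"
      using L' by (intro mult_right_mono le_imp_inverse_le) auto
    then show "inverse L * norm (x - x') \<le> norm (f x - f x')"
      using L'(3) x by (force simp: bi_Lipschitz_on_def)
    have "L' * norm (x - x') \<le> L * norm (x - x')"
      using L' by (intro mult_right_mono) auto
    then show "norm (f x - f x') \<le> L * norm (x - x')"
      using L'(3) x by (force simp: bi_Lipschitz_on_def)
  qed
qed

lemma F_INV_Lip_measurable:
  assumes "f \<in> F_INV_Lip \<Lambda>"
  shows "f \<in> borel_measurable (restrict_space borel square)"
proof -
  obtain L where "1 \<le> L" "bi_Lipschitz_on L square f"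
    using assms by (auto simp: F_INV_Lip_def)
  then have "L-lipschitz_on square f"
    by (auto simp: bi_Lipschitz_on_def dist_norm intro!: lipschitz_onI)
  then have "continuous_on square f" by (rule lipschitz_on_continuous_on)
  then show ?thesis by (rule borel_measurable_continuous_on_restrict)
qed

lemma inv_into_F_INV_Lip:
  assumes "f \<in> F_INV_Lip \<Lambda>" "y \<in> square"
  shows "inv_into square f y \<in> square" "f (inv_into square f y) = y"
proof -
  have "y \<in> f ` square" using assms unfolding F_INV_Lip_def by blast
  then show "inv_into square f y \<in> square" "f (inv_into square f y) = y"
    by (auto intro: inv_into_into f_inv_into_f)
qed

lemma quasi_inverse_F_INV_Lip:
  assumes "f \<in> F_INV_Lip \<Lambda>" "y \<in> square"
  shows "quasi_inverse c f y = inv_into square f y"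
proof -
  have ex: "\<exists>!x. x \<in> square \<and> f x = y" using assms by (auto simp: F_INV_Lip_def)
  then show ?thesis
    using the1_equality[OF ex] inv_into_F_INV_Lip[OF assms] by (simp add: quasi_inverse_def)
qed

text \<open>Let \<open>x\<close> and \<open>z\<close> be the preimages of \<open>y\<close> under
  \<open>f\<close> and \<open>g\<close>. Since \<open>g z = y = f x\<close>, the lower Lipschitz
  bound of \<open>g\<close> turns the error \<open>norm (f x - g x)\<close> at the single point
  \<open>x\<close> into a bound for \<open>norm (z - x)\<close>.\<close>

lemma inv_into_F_INV_Lip_stable:
  assumes f: "f \<in> F_INV_Lip \<Lambda>" and g: "g \<in> F_INV_Lip (ereal L)" and L: "0 < L"
    and R: "\<And>x. x \<in> square \<Longrightarrow> norm (f x - g x) \<le> R" and y: "y \<in> square"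
  shows "norm (inv_into square g y - inv_into square f y) \<le> L * R"
proof -
  let ?x = "inv_into square f y" and ?z = "inv_into square g y"
  note x = inv_into_F_INV_Lip[OF f y] and z = inv_into_F_INV_Lip[OF g y]
  have "inverse L * norm (?z - ?x) \<le> norm (g ?z - g ?x)"
    using F_INV_Lip_bi_Lipschitz[OF g] x z by (auto simp: bi_Lipschitz_on_def)
  also have "\<dots> = norm (f ?x - g ?x)" using x z by simp
  also have "\<dots> \<le> R" by (rule R[OF x(1)])
  finally show ?thesis using L by (simp add: field_simps)
qed

section \<open>Norm inequalities\<close>

lemma norm_diff_square:
  assumes "x \<in> square" "y \<in> square"
  shows "norm (x - y) \<le> 4"
proof -
  have "norm (x - y) \<le> (\<Sum>j\<in>UNIV. \<bar>(x - y) $ j\<bar>)" by (rule norm_le_l1_cart)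
  also have "\<dots> \<le> (\<Sum>j\<in>(UNIV::2 set). 2)"
  proof (intro sum_mono)
    fix j :: 2
    have "\<bar>x $ j\<bar> \<le> 1" "\<bar>y $ j\<bar> \<le> 1" using assms by (simp_all add: mem_square_iff)
    then show "\<bar>(x - y) $ j\<bar> \<le> 2" by simp
  qed
  finally show ?thesis by simp
qed

text \<open>Squared norms are plain sums of integrals, so the extended square root disappears. All
  later estimates are in this form: the direct error is a squared norm, and the penalty
  \<open>z ^ 4\<close> is the square of one.\<close>

lemma L2_norm_power2: "(L2_norm P h)\<^sup>2 = (\<Sum>j\<in>UNIV. \<integral>\<^sup>+x. ennreal ((h x $ j)\<^sup>2) \<partial>P)"
proof -
  have "(ennreal_sqrt z)\<^sup>2 = z" for z
  proof (cases z)
    case (real r)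
    then show ?thesis by (simp add: ennreal_sqrt_def ennreal_power)
  qed (simp add: ennreal_sqrt_def)
  then show ?thesis by (simp add: L2_norm_def)
qed

lemma L2_norm_power2_bound:
  assumes "prob_space P" and b: "\<And>x. x \<in> space P \<Longrightarrow> norm (h x) \<le> b"
  shows "(L2_norm P h)\<^sup>2 \<le> ennreal (2 * b\<^sup>2)"
proof -
  interpret prob_space P by fact
  have "(\<integral>\<^sup>+x. ennreal ((h x $ j)\<^sup>2) \<partial>P) \<le> (\<integral>\<^sup>+x. ennreal (b\<^sup>2) \<partial>P)" for j
  proof (intro nn_integral_mono ennreal_leI)
    fix x assume "x \<in> space P"
    then have "\<bar>h x $ j\<bar> \<le> b" using b component_le_norm_cart order_trans by blast
    then show "(h x $ j)\<^sup>2 \<le> b\<^sup>2" by (metis abs_ge_zero power2_abs power_mono)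
  qed
  then have "(L2_norm P h)\<^sup>2 \<le> (\<Sum>j\<in>(UNIV::2 set). ennreal (b\<^sup>2))"
    unfolding L2_norm_power2 by (intro sum_mono) (simp add: emeasure_space_1)
  then show ?thesis by (simp add: ennreal_mult)
qed

lemma L2_norm_power2_triangle:
  assumes [measurable]: "\<And>j. (\<lambda>x. f x $ j) \<in> borel_measurable P" "\<And>j. (\<lambda>x. g x $ j) \<in> borel_measurable P"
    "\<And>j. (\<lambda>x. h x $ j) \<in> borel_measurable P"
  shows "(L2_norm P (\<lambda>x. f x - h x))\<^sup>2 \<le> 2 * (L2_norm P (\<lambda>x. f x - g x))\<^sup>2 + 2 * (L2_norm P (\<lambda>x. g x - h x))\<^sup>2"
proof -
  have "(\<integral>\<^sup>+x. ennreal (((f x - h x) $ j)\<^sup>2) \<partial>P)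
     \<le> 2 * (\<integral>\<^sup>+x. ennreal (((f x - g x) $ j)\<^sup>2) \<partial>P) + 2 * (\<integral>\<^sup>+x. ennreal (((g x - h x) $ j)\<^sup>2) \<partial>P)" for j
  proof -
    have "(\<integral>\<^sup>+x. ennreal (((f x - h x) $ j)\<^sup>2) \<partial>P)
       \<le> (\<integral>\<^sup>+x. 2 * ennreal (((f x - g x) $ j)\<^sup>2) + 2 * ennreal (((g x - h x) $ j)\<^sup>2) \<partial>P)"
    proof (intro nn_integral_mono)
      fix x
      have "((f x - h x) $ j)\<^sup>2 \<le> 2 * ((f x - g x) $ j)\<^sup>2 + 2 * ((g x - h x) $ j)\<^sup>2"
        using power2_add_le[of "(f x - g x) $ j" "(g x - h x) $ j"] by simp
      then have "ennreal (((f x - h x) $ j)\<^sup>2) \<le> ennreal (2 * ((f x - g x) $ j)\<^sup>2 + 2 * ((g x - h x) $ j)\<^sup>2)"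
        by (rule ennreal_leI)
      then show "ennreal (((f x - h x) $ j)\<^sup>2) \<le> 2 * ennreal (((f x - g x) $ j)\<^sup>2) + 2 * ennreal (((g x - h x) $ j)\<^sup>2)"
        by (simp add: ennreal_mult)
    qed
    then show ?thesis by (simp add: nn_integral_add nn_integral_cmult)
  qed
  then show ?thesis
    unfolding L2_norm_power2 sum_distrib_left sum.distrib[symmetric] by (rule sum_mono)
qed

text \<open>The Euclidean norm is at most the sum of the two coordinates; this is the origin of the
  \<open>2 * r\<close> in the votes.\<close>

lemma Linf_norm_leD:
  assumes "Linf_norm h \<le> ennreal r" "0 \<le> r" "x \<in> square"
  shows "norm (h x) \<le> 2 * r"
proof -
  have "\<bar>h x $ j\<bar> \<le> r" for j
  proof -
    have "ennreal \<bar>h x $ j\<bar> \<le> (SUP x\<in>square. ennreal \<bar>h x $ j\<bar>)"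
      using assms(3) by (rule SUP_upper)
    also have "\<dots> \<le> Linf_norm h"
      unfolding Linf_norm_def by (rule Max_ge) auto
    also note assms(1)
    finally show ?thesis using assms(2) by simp
  qed
  then have "norm (h x) \<le> (\<Sum>j\<in>(UNIV::2 set). r)"
    by (intro order_trans[OF norm_le_l1_cart] sum_mono) auto
  then show ?thesis by simp
qed

text \<open>The least index satisfying a measurable optimality predicate is a measurable choice. If
  there is no candidate, \<open>ok\<close> holds vacuously for every index below \<open>N\<close>,
  so the selection is defined for all \<open>D\<close> and falls back to 0.\<close>

lemma measurable_constrained_argmin:
  fixes score :: "'a \<Rightarrow> nat \<Rightarrow> ennreal" and cand :: "'a \<Rightarrow> nat \<Rightarrow> bool"
  assumes "0 < N"
    and [measurable]: "\<And>i. i < N \<Longrightarrow> (\<lambda>D. score D i) \<in> borel_measurable M"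
    and [measurable]: "\<And>i. i < N \<Longrightarrow> Measurable.pred M (\<lambda>D. cand D i)"
  obtains idx where "idx \<in> measurable M (count_space UNIV)" "\<And>D. idx D < N"
    "\<And>D i. i < N \<Longrightarrow> cand D i \<Longrightarrow> cand D (idx D) \<and> score D (idx D) \<le> score D i"
proof -
  define ok where "ok D i \<longleftrightarrow> i < N \<and> (\<forall>l<N. cand D l \<longrightarrow> cand D i \<and> score D i \<le> score D l)" for D i
  have ex: "\<exists>i. ok D i" for D
  proof (cases "\<exists>l<N. cand D l")
    case True
    let ?C = "{l. l < N \<and> cand D l}"
    have "finite ?C" "?C \<noteq> {}" using True by auto
    then obtain i where "i \<in> ?C" "\<And>l. l \<in> ?C \<Longrightarrow> score D i \<le> score D l"
      using arg_min_least[where S="?C" and f="score D"] arg_min_if_finite(1)[where S="?C" and f="score D"] by blast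
    then show ?thesis by (auto simp: ok_def)
  qed (use assms(1) in \<open>auto simp: ok_def\<close>)
  have okm: "Measurable.pred M (\<lambda>D. ok D i)" for i
  proof (cases "i < N")
    case True
    have "Measurable.pred M (\<lambda>D. \<forall>l\<in>{..<N}. cand D l \<longrightarrow> cand D i \<and> score D i \<le> score D l)"
    proof (intro pred_intros_finite)
      fix l assume "l \<in> {..<N}"
      then have [measurable]: "(\<lambda>D. score D i) \<in> borel_measurable M" "(\<lambda>D. score D l) \<in> borel_measurable M"
          "Measurable.pred M (\<lambda>D. cand D l)" "Measurable.pred M (\<lambda>D. cand D i)"
        using True assms(2,3) by auto
      show "Measurable.pred M (\<lambda>D. cand D l \<longrightarrow> cand D i \<and> score D i \<le> score D l)" by measurable
    qed simp
    then show ?thesis using True by (simp add: ok_def Ball_def)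
  qed (simp add: ok_def)
  show thesis
  proof
    show "(\<lambda>D. LEAST i. ok D i) \<in> measurable M (count_space UNIV)"
      using okm by (intro measurable_Least) auto
    have "ok D (LEAST i. ok D i)" for D using ex by (rule LeastI_ex)
    then show "(LEAST i. ok D i) < N"
      "i < N \<Longrightarrow> cand D i \<Longrightarrow> cand D (LEAST i. ok D i) \<and> score D (LEAST i. ok D i) \<le> score D i" for D i
      unfolding ok_def by blast+
  qed
qed

section \<open>Selection by majority vote\<close>

text \<open>The identity witnesses that the class is nonempty, and therefore that its net has a
  member to select.\<close>

lemma id_F_INV_Lip:
  assumes "1 \<le> L"
  shows "(\<lambda>x. x) \<in> F_INV_Lip (ereal L)"
proof -
  have "bi_Lipschitz_on 1 square (\<lambda>x. x)" by (simp add: bi_Lipschitz_on_def)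
  then have "\<exists>L'\<ge>1. ereal L' \<le> ereal L \<and> bi_Lipschitz_on L' square (\<lambda>x. x)"
    using assms by (intro exI[of _ 1]) simp
  then show ?thesis by (auto simp: F_INV_Lip_def)
qed

lemma measurable_estimator_at:
  assumes "g \<in> estimators n" "x \<in> square"
  shows "(\<lambda>D. g D x) \<in> borel_measurable (data_space n)"
proof -
  have "(\<lambda>D. (D, x)) \<in> measurable (data_space n) (data_space n \<Otimes>\<^sub>M restrict_space borel square)"
    using assms(2) by (intro measurable_Pair measurable_const) (auto simp: space_restrict_space)
  from measurable_compose[OF this, of "\<lambda>(D, x). g D x" borel] show ?thesis
    using assms(1) by (simp add: estimators_def)
qed

lemma measurable_L2_norm_histogram:
  assumes p: "design_density p" and \<A>: "cell_partition d \<A>"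
    and [measurable]: "f \<in> borel_measurable (restrict_space borel square)"
  shows "(\<lambda>D. (L2_norm (design_law p) (\<lambda>x. f x - histogram p n \<A> D x))\<^sup>2) \<in> borel_measurable (data_space n)"
    and "(\<lambda>D. (L2_norm (design_law p) (\<lambda>x. histogram p n \<A> D x - f x))\<^sup>2) \<in> borel_measurable (data_space n)"
proof -
  interpret P: prob_space "design_law p" using p by (rule prob_space_design_law)
  have [measurable_cong]: "sets (data_space n \<Otimes>\<^sub>M design_law p) = sets (data_space n \<Otimes>\<^sub>M restrict_space borel square)"
    by (intro sets_pair_measure_cong refl sets_design_law)
  have h[measurable]: "(\<lambda>z. histogram p n \<A> (fst z) (snd z) $ j) \<in> borel_measurable (data_space n \<Otimes>\<^sub>M design_law p)" for j
    using measurable_histogram[OF \<A>, of p n j] by (simp add: case_prod_unfold cong: measurable_cong_sets)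
  have eq: "(L2_norm (design_law p) (\<lambda>x. f x - histogram p n \<A> D x))\<^sup>2
      = (L2_norm (design_law p) (\<lambda>x. histogram p n \<A> D x - f x))\<^sup>2" for D
    unfolding L2_norm_power2 by (simp add: power2_commute)
  show "(\<lambda>D. (L2_norm (design_law p) (\<lambda>x. histogram p n \<A> D x - f x))\<^sup>2) \<in> borel_measurable (data_space n)"
    unfolding L2_norm_power2
    by (intro borel_measurable_sum P.borel_measurable_nn_integral) (simp add: case_prod_unfold, measurable)
  then show "(\<lambda>D. (L2_norm (design_law p) (\<lambda>x. f x - histogram p n \<A> D x))\<^sup>2) \<in> borel_measurable (data_space n)"
    unfolding eq .
qed

text \<open>Joint measurability in data and point is glued from the finitely many pieces on which
  the selected index is constant.\<close>

lemma estimator_of_index: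
  assumes idx: "idx \<in> measurable (data_space n) (count_space UNIV)"
    and D0: "\<And>D. idx D < (N :: nat)"
    and Gm: "\<And>i. i < N \<Longrightarrow> G i \<in> borel_measurable (restrict_space borel square)"
  shows "(\<lambda>D. G (idx D)) \<in> estimators n"
proof -
  let ?M = "data_space n \<Otimes>\<^sub>M restrict_space borel square"
  have "(\<lambda>z. G (idx (fst z)) (snd z)) \<in> borel_measurable ?M"
  proof (rule measurable_compose_countable'[where I="{..<N}" and f="\<lambda>i z. G i (snd z)" and g="\<lambda>z. idx (fst z)"])
    show "(\<lambda>z. G i (snd z)) \<in> borel_measurable ?M" if "i \<in> {..<N}" for i
      using that by (intro measurable_compose[OF measurable_snd Gm]) simp
    have "(\<lambda>z. idx (fst z)) \<in> measurable ?M (count_space UNIV)"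
      by (rule measurable_compose[OF measurable_fst idx])
    then show "(\<lambda>z. idx (fst z)) \<in> measurable ?M (count_space {..<N})"
      using D0 by (auto simp: measurable_def space_pair_measure)
  qed simp
  then show ?thesis by (simp add: estimators_def case_prod_unfold)
qed

text \<open>Both guarantees are deterministic: they hold for every data set on which more than half
  of the blocks estimate \<open>f\<close> well. A block votes for a net member if it agrees with it
  up to \<open>2 * r + \<epsilon>\<close> on a finite set of points; a good block therefore votes
  for the net neighbour of \<open>f\<close>, which becomes a candidate. Conversely the selected
  member has a majority too, and two majorities share a block, through which it is compared with
  \<open>f\<close>. The bound on the squared distance comes from minimality of the score against
  that net neighbour.\<close>

lemma exists_majority_estimator:
  fixes L r \<epsilon> :: real and fh :: estimator
  defines "F \<equiv> F_INV_Lip (ereal L)"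
  assumes p: "design_density p" and L: "1 \<le> L" and \<epsilon>: "0 < \<epsilon>"
    and fh: "fh \<in> estimators m" and Km: "K * m \<le> n" and \<A>: "cell_partition d \<A>"
  obtains g where "g \<in> estimators n" "\<And>D. g D \<in> F"
    "\<And>f D x. f \<in> F \<Longrightarrow> K < 2 * card {j. j < K \<and> (\<forall>x\<in>square. norm (fh (block m j D) x - f x) \<le> 2 * r)}
       \<Longrightarrow> x \<in> square \<Longrightarrow> norm (f x - g D x) \<le> 4 * r + 2 * \<epsilon>"
    "\<And>f D. f \<in> F \<Longrightarrow> K < 2 * card {j. j < K \<and> (\<forall>x\<in>square. norm (fh (block m j D) x - f x) \<le> 2 * r)}
       \<Longrightarrow> (L2_norm (design_law p) (\<lambda>x. g D x - f x))\<^sup>2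
         \<le> ennreal (8 * \<epsilon>\<^sup>2) + 6 * (L2_norm (design_law p) (\<lambda>x. histogram p n \<A> D x - f x))\<^sup>2"
proof -
  let ?P = "design_law p" and ?H = "histogram p n \<A>"
  interpret P: prob_space ?P using p by (rule prob_space_design_law)
  have Fsq: "f x \<in> square" if "f \<in> F" "x \<in> square" for f x
    using that F_INV_Lip_in_square by (auto simp: F_def)
  have FL: "norm (f x - f x') \<le> L * norm (x - x')" if "f \<in> F" "x \<in> square" "x' \<in> square" for f x x'
    using F_INV_Lip_bi_Lipschitz[of f L] that by (auto simp: F_def bi_Lipschitz_on_def)
  have Fm: "f \<in> borel_measurable (restrict_space borel square)" if "f \<in> F" for f
    using that F_INV_Lip_measurable by (auto simp: F_def)
  have L0: "0 < L" using L by simp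
  \<comment> \<open>With this spacing, moving from \<open>x\<close> to the nearest test point
    changes any member of the class by at most \<open>\<epsilon> / 2\<close>.\<close>
  obtain T where T: "finite T" "T \<subseteq> square" "\<And>x. x \<in> square \<Longrightarrow> \<exists>t\<in>T. norm (x - t) \<le> \<epsilon> / (2 * L)"
    by (rule finite_dense_square[of "\<epsilon> / (2 * L)"]) (use \<epsilon> L0 in simp_all)
  obtain G0 where G0: "finite G0" "G0 \<subseteq> F" "\<And>f. f \<in> F \<Longrightarrow> \<exists>g\<in>G0. \<forall>x\<in>square. norm (f x - g x) \<le> \<epsilon>"
  proof -
    have "\<exists>G\<subseteq>F. finite G \<and> (\<forall>f\<in>F. \<exists>g\<in>G. \<forall>x\<in>square. norm (f x - g x) \<le> \<epsilon>)"
      by (rule finite_uniform_net[OF \<epsilon> L0]) (simp_all add: Fsq FL)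
    with that show ?thesis by blast
  qed
  obtain N :: nat and G where G: "G0 = G ` {i. i < N}"
    using finite_imp_nat_seg_image_inj_on[OF G0(1)] by blast
  have GF: "G i \<in> F" if "i < N" for i using that G G0(2) by auto
  have "(\<lambda>x. x) \<in> F" using id_F_INV_Lip L by (simp add: F_def)
  then have N: "0 < N" using G0(3) G by fastforce
  define vote where "vote D j i \<longleftrightarrow> (\<forall>t\<in>T. norm (fh (block m j D) t - G i t) \<le> 2 * r + \<epsilon>)" for D j i
  define cand where "cand D i \<longleftrightarrow> K < 2 * card {j. j < K \<and> vote D j i}" for D i
  define score where "score D i = (L2_norm ?P (\<lambda>x. G i x - ?H D x))\<^sup>2" for D i
  \<comment> \<open>A vote is a finite conjunction over \<open>T\<close>, hence an event of the
    product algebra, unlike a condition on the whole square.\<close>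
  have votem[measurable]: "Measurable.pred (data_space n) (\<lambda>D. vote D j i)" if "j < K" for i j
    unfolding vote_def
  proof (intro pred_intros_finite T(1))
    fix t assume "t \<in> T"
    then have "t \<in> square" using T by auto
    then have [measurable]: "(\<lambda>D. fh (block m j D) t) \<in> borel_measurable (data_space n)"
      using measurable_compose[OF measurable_block[OF that Km] measurable_estimator_at[OF fh, unfolded data_space_def]]
      unfolding data_space_def by simp
    show "Measurable.pred (data_space n) (\<lambda>D. norm (fh (block m j D) t - G i t) \<le> 2 * r + \<epsilon>)"
      by measurable
  qed
  have "Measurable.pred (data_space n) (\<lambda>D. cand D i)" for i
  proof -
    \<comment> \<open>The number of votes is written as a sum of indicators to make it a measurable
      function of the data.\<close>
    have c: "real (card {j. j < K \<and> vote D j i}) = (\<Sum>j<K. if vote D j i then 1 else 0)" for D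
    proof -
      have "{..<K} \<inter> {j. vote D j i} = {j. j < K \<and> vote D j i}" by auto
      then show ?thesis by (simp add: sum.If_cases)
    qed
    have "(\<lambda>D. \<Sum>j<K. if vote D j i then 1 else (0::real)) \<in> borel_measurable (data_space n)"
    proof (intro borel_measurable_sum)
      fix j assume "j \<in> {..<K}"
      then have [measurable]: "Measurable.pred (data_space n) (\<lambda>D. vote D j i)" by simp
      show "(\<lambda>D. if vote D j i then 1 else (0::real)) \<in> borel_measurable (data_space n)" by measurable
    qed
    then have "Measurable.pred (data_space n) (\<lambda>D. real K < 2 * (\<Sum>j<K. if vote D j i then 1 else (0::real)))"
      by measurable
    moreover have "cand D i \<longleftrightarrow> real K < 2 * (\<Sum>j<K. if vote D j i then 1 else (0::real))" for D
      unfolding cand_def c[symmetric] using of_nat_less_iff[of K "2 * card {j. j < K \<and> vote D j i}", where 'a=real]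
      by simp
    ultimately show ?thesis by simp
  qed
  moreover have "(\<lambda>D. score D i) \<in> borel_measurable (data_space n)" if "i < N" for i
    unfolding score_def by (rule measurable_L2_norm_histogram[OF p \<A> Fm[OF GF[OF that]]])
  ultimately obtain idx where idx: "idx \<in> measurable (data_space n) (count_space UNIV)" "\<And>D. idx D < N"
    "\<And>D i. i < N \<Longrightarrow> cand D i \<Longrightarrow> cand D (idx D) \<and> score D (idx D) \<le> score D i"
    using measurable_constrained_argmin[OF N, of score "data_space n" cand] by blast
  define g where "g D = G (idx D)" for D
  have gF: "g D \<in> F" for D unfolding g_def using GF idx(2) by blast
  have gest: "g \<in> estimators n"
    unfolding g_def[abs_def] using idx(2) GF Fm by (intro estimator_of_index[OF idx(1)]) blast+
  have main: "(\<forall>x\<in>square. norm (f x - g D x) \<le> 4 * r + 2 * \<epsilon>) \<and>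
      (L2_norm ?P (\<lambda>x. g D x - f x))\<^sup>2 \<le> ennreal (8 * \<epsilon>\<^sup>2) + 6 * (L2_norm ?P (\<lambda>x. ?H D x - f x))\<^sup>2"
    if f: "f \<in> F" and maj: "K < 2 * card {j. j < K \<and> (\<forall>x\<in>square. norm (fh (block m j D) x - f x) \<le> 2 * r)}"
      (is "_ < 2 * card ?J") for f D
  proof -
    obtain i where i: "i < N" "\<And>x. x \<in> square \<Longrightarrow> norm (f x - G i x) \<le> \<epsilon>"
      using G0(3)[OF f] G by blast
    have "?J \<subseteq> {j. j < K \<and> vote D j i}"
    proof safe
      fix j assume j: "\<forall>x\<in>square. norm (fh (block m j D) x - f x) \<le> 2 * r"
      show "vote D j i" unfolding vote_def
      proof
        fix t assume "t \<in> T"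
        then have t: "t \<in> square" using T by auto
        have "norm (fh (block m j D) t - G i t) \<le> norm (fh (block m j D) t - f t) + norm (f t - G i t)"
          using norm_triangle_ineq[of "fh (block m j D) t - f t" "f t - G i t"] by simp
        then show "norm (fh (block m j D) t - G i t) \<le> 2 * r + \<epsilon>" using j i(2)[OF t] t by force
      qed
    qed
    then have "card ?J \<le> card {j. j < K \<and> vote D j i}" by (intro card_mono) auto
    then have "cand D i" using maj by (simp add: cand_def)
    then have sel: "cand D (idx D)" "score D (idx D) \<le> score D i" using idx(3) i(1) by blast+
    \<comment> \<open>Two sets of blocks that each hold more than half of the \<open>K\<close>
      blocks cannot be disjoint.\<close>
    have "?J \<inter> {j. j < K \<and> vote D j (idx D)} \<noteq> {}"
    proof
      assume e: "?J \<inter> {j. j < K \<and> vote D j (idx D)} = {}"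
      have "card ?J + card {j. j < K \<and> vote D j (idx D)} = card (?J \<union> {j. j < K \<and> vote D j (idx D)})"
        using e by (intro card_Un_disjoint[symmetric]) auto
      also have "\<dots> \<le> card {..<K}" by (intro card_mono) auto
      finally show False using maj sel(1) by (simp add: cand_def)
    qed
    then obtain j where j: "\<forall>x\<in>square. norm (fh (block m j D) x - f x) \<le> 2 * r" "vote D j (idx D)" by auto
    have close: "norm (f x - g D x) \<le> 4 * r + 2 * \<epsilon>" if x: "x \<in> square" for x
    proof -
      obtain t where t: "t \<in> T" "norm (x - t) \<le> \<epsilon> / (2 * L)" using T(3)[OF x] by blast
      have tsq: "t \<in> square" using t T by auto
      have lip: "norm (h x - h t) \<le> \<epsilon> / 2" if "h \<in> F" for h
      proof -
        have "norm (h x - h t) \<le> L * norm (x - t)" by (rule FL[OF that x tsq])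
        also have "\<dots> \<le> L * (\<epsilon> / (2 * L))" using t L0 by (intro mult_left_mono) auto
        finally show ?thesis using L0 by simp
      qed
      have tri: "norm (a - b - c + d) \<le> norm a + norm b + norm c + norm d" for a b c d :: "real^2"
        using norm_triangle_ineq[of "a - b - c" d] norm_triangle_ineq4[of "a - b" c] norm_triangle_ineq4[of a b]
        by linarith
      \<comment> \<open>The path runs from \<open>f x\<close> to \<open>g D x\<close> through the
        test point \<open>t\<close> and the common block: two Lipschitz steps of
        \<open>\<epsilon> / 2\<close>, the good block with \<open>2 * r\<close>, and its vote with
        \<open>2 * r + \<epsilon>\<close>.\<close>
      have "norm (f x - g D x) \<le> norm (f x - f t) + norm (fh (block m j D) t - f t) + norm (g D x - g D t) + norm (fh (block m j D) t - g D t)"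
        using tri[of "f x - f t" "fh (block m j D) t - f t" "g D x - g D t" "fh (block m j D) t - g D t"] by simp
      moreover have "norm (fh (block m j D) t - f t) \<le> 2 * r" using j(1) tsq by blast
      moreover have "norm (fh (block m j D) t - g D t) \<le> 2 * r + \<epsilon>"
        using j(2) t(1) by (simp add: vote_def g_def)
      ultimately show ?thesis using lip[OF f] lip[OF gF[of D]] by linarith
    qed
    have comp: "(\<lambda>x. h x $ j) \<in> borel_measurable ?P" if "h \<in> F" for h j
      unfolding measurable_cong_sets[OF sets_design_law refl] using Fm[OF that] by measurable
    have Hm: "(\<lambda>x. ?H D x $ j) \<in> borel_measurable ?P" for j
      unfolding measurable_cong_sets[OF sets_design_law refl] histogram_def vec_lambda_beta
      using \<A> by (intro borel_measurable_sum borel_measurable_times borel_measurable_indicator)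
        (auto simp: cell_partition_def)
    let ?Hf = "(L2_norm ?P (\<lambda>x. ?H D x - f x))\<^sup>2"
    have sym: "(L2_norm ?P (\<lambda>x. f x - ?H D x))\<^sup>2 = ?Hf"
      unfolding L2_norm_power2 by (simp add: power2_commute)
    have "(L2_norm ?P (\<lambda>x. G i x - f x))\<^sup>2 \<le> ennreal (2 * \<epsilon>\<^sup>2)"
      using i(2) by (intro L2_norm_power2_bound P.prob_space_axioms) (simp add: norm_minus_commute)
    then have "2 * (L2_norm ?P (\<lambda>x. G i x - f x))\<^sup>2 + 2 * (L2_norm ?P (\<lambda>x. f x - ?H D x))\<^sup>2
        \<le> 2 * ennreal (2 * \<epsilon>\<^sup>2) + 2 * ?Hf"
      unfolding sym by (intro add_mono mult_left_mono) auto
    then have si: "score D i \<le> 2 * ennreal (2 * \<epsilon>\<^sup>2) + 2 * ?Hf"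
      unfolding score_def using L2_norm_power2_triangle[of "G i" ?P f "?H D", OF comp[OF GF[OF i(1)]] comp[OF f] Hm]
      by (rule order_trans[rotated])
    have "(L2_norm ?P (\<lambda>x. g D x - f x))\<^sup>2 \<le> 2 * score D (idx D) + 2 * ?Hf"
      unfolding score_def g_def
      by (rule L2_norm_power2_triangle[OF comp[OF GF[OF idx(2)]] Hm comp[OF f]])
    \<comment> \<open>Three triangle inequalities: from the selected member to the histogram to
      \<open>f\<close>, minimality of the score in between, and from the net neighbour over
      \<open>f\<close> to the histogram. The inner \<open>2 * \<epsilon>\<^sup>2\<close> counts the
      two coordinates.\<close>
    also have "\<dots> \<le> 2 * (2 * ennreal (2 * \<epsilon>\<^sup>2) + 2 * ?Hf) + 2 * ?Hf"
      using order_trans[OF sel(2) si] by (intro add_mono mult_left_mono) auto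
    also have "\<dots> = 4 * ennreal (2 * \<epsilon>\<^sup>2) + 6 * ?Hf"
    proof -
      have "6 * ?Hf = 4 * ?Hf + 2 * ?Hf" by (subst distrib_right[symmetric]) simp
      then show ?thesis by (simp add: distrib_left mult.assoc[symmetric] add.assoc)
    qed
    also have "4 * ennreal (2 * \<epsilon>\<^sup>2) = ennreal (8 * \<epsilon>\<^sup>2)"
      by (simp add: ennreal_mult mult.assoc[symmetric])
    finally show ?thesis using close by blast
  qed
  show thesis
  proof (rule that[OF gest gF])
    fix f D assume "f \<in> F" "K < 2 * card {j. j < K \<and> (\<forall>x\<in>square. norm (fh (block m j D) x - f x) \<le> 2 * r)}"
    note m = main[OF this]
    show "x \<in> square \<Longrightarrow> norm (f x - g D x) \<le> 4 * r + 2 * \<epsilon>" for x using m by blast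
    show "(L2_norm ?P (\<lambda>x. g D x - f x))\<^sup>2 \<le> ennreal (8 * \<epsilon>\<^sup>2) + 6 * (L2_norm ?P (\<lambda>x. ?H D x - f x))\<^sup>2"
      using m by blast
  qed
qed

text \<open>The event is measurable for the completion only; the product arguments need a set of the algebra itself.\<close>
lemma Linf_error_prob_inner:
  assumes "a \<le> Linf_error_prob p \<sigma> m fh f r" "0 < a"
  shows "\<exists>S\<in>sets (data_law p \<sigma> m f). a \<le> measure (data_law p \<sigma> m f) S \<and>
    (\<forall>D\<in>S. Linf_norm (\<lambda>x. fh D x - f x) \<le> ennreal r)"
proof -
  let ?M = "data_law p \<sigma> m f"
  let ?E = "{D \<in> space (data_space m). Linf_norm (\<lambda>x. fh D x - f x) \<le> ennreal r}"
  \<comment> \<open>\<open>measure\<close> is 0 outside the algebra, so the positive lower bound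
    \<open>a\<close> itself forces the event to be measurable for the completion.\<close>
  have "?E \<in> sets (completion ?M)"
    using assms measure_notin_sets[of ?E "completion ?M"] by (fastforce simp: Linf_error_prob_def)
  note E = this
  show ?thesis
  proof (intro bexI[of _ "main_part ?M ?E"] conjI ballI)
    show "main_part ?M ?E \<in> sets ?M" using E by (rule main_part_sets)
    show "a \<le> measure ?M (main_part ?M ?E)"
      using assms(1) emeasure_completion[OF E] by (simp add: Linf_error_prob_def measure_def)
    show "Linf_norm (\<lambda>x. fh D x - f x) \<le> ennreal r" if "D \<in> main_part ?M ?E" for D
      using main_part_null_part_Un[OF E] that by blast
  qed
qed

text \<open>The estimator is fixed before \<open>f\<close>, so a bound for each \<open>f\<close>
  bounds the supremum. Off the event that at most half of the blocks are good, uniform closeness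
  \<open>R\<close> gives inverse error \<open>L * R\<close>, hence a squared norm of at most
  \<open>2 * (L * R)\<^sup>2\<close> and a penalty of \<open>4 * (L * R) ^ 4\<close>; the direct
  error is passed to the histogram. On that event crude bounds by the size of the square are paid
  with probability \<open>(1/2) ^ K\<close>.\<close>

lemma minimax_inverse_risk_le:
  fixes L r \<epsilon> \<delta> \<sigma> :: real and fh :: estimator
  defines "F \<equiv> F_INV_Lip (ereal L)"
  assumes p: "design_density p" and \<sigma>: "0 < \<sigma>" and L: "1 \<le> L" and \<epsilon>: "0 < \<epsilon>" and r: "0 \<le> r" and n: "0 < n"
    and fh: "fh \<in> estimators m" and Km: "K * m \<le> n" and \<A>: "cell_partition d \<A>"
    and prob: "\<And>f. f \<in> F \<Longrightarrow> 1 - \<delta> \<le> Linf_error_prob p \<sigma> m fh f r" and \<delta>: "\<delta> \<le> 1/15"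
  shows "(INF g\<in>estimators n. SUP f\<in>F. inverse_risk (\<lambda>z. z ^ 4) c p \<sigma> n g f)
    \<le> ennreal (8 * \<epsilon>\<^sup>2 + 4 * (L * (4 * r + 2 * \<epsilon>)) ^ 4
        + 12 * (real (card \<A>) * (2 * (1 + \<sigma>\<^sup>2)) / n + 2 * (L * d)\<^sup>2) + 1056 * (1/2) ^ K)"
proof -
  let ?P = "design_law p" and ?H = "histogram p n \<A>"
  interpret P: prob_space ?P using p by (rule prob_space_design_law)
  define R where "R = 4 * r + 2 * \<epsilon>"
  obtain g where g: "g \<in> estimators n" and gF: "\<And>D. g D \<in> F" and
    close: "\<And>f D x. f \<in> F \<Longrightarrow> K < 2 * card {j. j < K \<and> (\<forall>x\<in>square. norm (fh (block m j D) x - f x) \<le> 2 * r)}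
       \<Longrightarrow> x \<in> square \<Longrightarrow> norm (f x - g D x) \<le> R" and
    l2: "\<And>f D. f \<in> F \<Longrightarrow> K < 2 * card {j. j < K \<and> (\<forall>x\<in>square. norm (fh (block m j D) x - f x) \<le> 2 * r)}
       \<Longrightarrow> (L2_norm ?P (\<lambda>x. g D x - f x))\<^sup>2 \<le> ennreal (8 * \<epsilon>\<^sup>2) + 6 * (L2_norm ?P (\<lambda>x. ?H D x - f x))\<^sup>2"
    unfolding F_def R_def by (rule exists_majority_estimator[OF p L \<epsilon> fh Km \<A>, of r]) blast
  show ?thesis
  proof (rule INF_lower2[OF g], rule SUP_least)
    fix f assume f: "f \<in> F"
    let ?Q = "data_law p \<sigma> n f"
    have fm: "f \<in> borel_measurable (restrict_space borel square)"
      using f F_INV_Lip_measurable by (simp add: F_def)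
    have fsq: "h x \<in> square" if "h \<in> F" "x \<in> square" for h x
      using that F_INV_Lip_in_square by (auto simp: F_def)
    have fL: "norm (f x - f x') \<le> L * norm (x - x')" if "x \<in> square" "x' \<in> square" for x x'
      using F_INV_Lip_bi_Lipschitz[of f L] f that by (auto simp: F_def bi_Lipschitz_on_def)
    interpret Q: prob_space ?Q using p \<sigma> fm by (rule prob_space_data_law)
    have pos: "0 < 1 - \<delta>" using \<delta> by simp
    obtain S where S: "S \<in> sets (data_law p \<sigma> m f)" "1 - \<delta> \<le> measure (data_law p \<sigma> m f) S"
      "\<And>D. D \<in> S \<Longrightarrow> Linf_norm (\<lambda>x. fh D x - f x) \<le> ennreal r"
      using Linf_error_prob_inner[OF prob[OF f] pos] by blast
    \<comment> \<open>The bad event is defined with the measurable inner set \<open>S\<close> in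
      place of the uniform norm, which makes it an event of the product algebra. It depends on
      \<open>f\<close>; the estimator does not.\<close>
    define B where "B = {D \<in> space ?Q. 2 * card {j. j < K \<and> block m j D \<in> S} \<le> K}"
    have Bbound: "emeasure ?Q B \<le> ennreal ((1/2) ^ K)"
      using emeasure_few_good_blocks[OF prob_space_obs_law[OF p \<sigma> fm] Km S(1,2)[unfolded data_law_def] \<delta>]
      unfolding B_def data_law_def .
    have [measurable]: "Measurable.pred ?Q (\<lambda>D. block m j D \<in> S)" if "j < K" for j
      unfolding data_law_def using measurable_block[OF that Km] S(1)[unfolded data_law_def] by (rule pred_sets2[rotated])
    have Bm: "B \<in> sets ?Q"
    proof -
      have c: "real (card {j. j < K \<and> block m j D \<in> S}) = (\<Sum>j<K. if block m j D \<in> S then 1 else 0)" for D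
      proof -
        have "{..<K} \<inter> {j. block m j D \<in> S} = {j. j < K \<and> block m j D \<in> S}" by auto
        then show ?thesis by (simp add: sum.If_cases)
      qed
      have "(\<lambda>D. \<Sum>j<K. if block m j D \<in> S then 1 else (0::real)) \<in> borel_measurable ?Q"
      proof (intro borel_measurable_sum)
        fix j assume "j \<in> {..<K}"
        then have [measurable]: "Measurable.pred ?Q (\<lambda>D. block m j D \<in> S)" by simp
        show "(\<lambda>D. if block m j D \<in> S then 1 else (0::real)) \<in> borel_measurable ?Q" by measurable
      qed
      then have "Measurable.pred ?Q (\<lambda>D. 2 * (\<Sum>j<K. if block m j D \<in> S then 1 else (0::real)) \<le> real K)"
        by measurable
      moreover have "2 * card {j. j < K \<and> block m j D \<in> S} \<le> K \<longleftrightarrow> 2 * (\<Sum>j<K. if block m j D \<in> S then 1 else (0::real)) \<le> real K" for D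
        unfolding c[symmetric] using of_nat_le_iff[of "2 * card {j. j < K \<and> block m j D \<in> S}" K, where 'a=real] by simp
      ultimately show ?thesis unfolding B_def by (simp add: pred_def)
    qed
    have good: "K < 2 * card {j. j < K \<and> (\<forall>x\<in>square. norm (fh (block m j D) x - f x) \<le> 2 * r)}"
      if "D \<in> space ?Q" "D \<notin> B" for D
    proof -
      have "{j. j < K \<and> block m j D \<in> S} \<subseteq> {j. j < K \<and> (\<forall>x\<in>square. norm (fh (block m j D) x - f x) \<le> 2 * r)}"
        using S(3) Linf_norm_leD r by blast
      then have "card {j. j < K \<and> block m j D \<in> S} \<le> card {j. j < K \<and> (\<forall>x\<in>square. norm (fh (block m j D) x - f x) \<le> 2 * r)}"
        by (intro card_mono) auto
      then show ?thesis using that by (simp add: B_def)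
    qed
    \<comment> \<open>\<open>a\<close> and \<open>b\<close> are squared norms, so the penalty is the
      square of \<open>b\<close>.\<close>
    define a b h where "a D = (L2_norm ?P (\<lambda>x. g D x - f x))\<^sup>2"
      and "b D = (L2_norm ?P (\<lambda>y. quasi_inverse c (g D) y - inv_into square f y))\<^sup>2"
      and "h D = (L2_norm ?P (\<lambda>x. ?H D x - f x))\<^sup>2" for D
    have qi: "quasi_inverse c (g D) y = inv_into square (g D) y" if "y \<in> square" for D y
      using quasi_inverse_F_INV_Lip gF that unfolding F_def by blast
    have b_good: "b D \<le> ennreal (2 * (L * R)\<^sup>2)" if "D \<in> space ?Q" "D \<notin> B" for D
      unfolding b_def
    proof (intro L2_norm_power2_bound P.prob_space_axioms)
      fix y assume "y \<in> space ?P"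
      then have y: "y \<in> square" by simp
      have "norm (inv_into square (g D) y - inv_into square f y) \<le> L * R"
        using inv_into_F_INV_Lip_stable[OF f[unfolded F_def] gF[unfolded F_def], of D R y]
          close[OF f good[OF that]] y L by simp
      then show "norm (quasi_inverse c (g D) y - inv_into square f y) \<le> L * R" using qi y by simp
    qed
    \<comment> \<open>\<open>g D\<close> belongs to the class for every data set, also when the vote
      fails, so it and its inverse take values in the square. Distances there are at most 4, and two
      coordinates give \<open>2 * 4\<^sup>2 = 32\<close>.\<close>
    have a_bad: "a D \<le> ennreal 32" for D
      using L2_norm_power2_bound[OF P.prob_space_axioms, of "\<lambda>x. g D x - f x" 4] norm_diff_square fsq gF f
      by (simp add: a_def)
    have b_bad: "b D \<le> ennreal 32" for D
    proof -
      have "norm (quasi_inverse c (g D) y - inv_into square f y) \<le> 4" if "y \<in> space ?P" for y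
        using that qi inv_into_F_INV_Lip(1)[OF f[unfolded F_def]] inv_into_F_INV_Lip(1)[OF gF[unfolded F_def]]
        by (simp add: norm_diff_square)
      from L2_norm_power2_bound[OF P.prob_space_axioms this] show ?thesis by (simp add: b_def)
    qed
    have pointwise: "a D + (b D)\<^sup>2 \<le> ennreal (8 * \<epsilon>\<^sup>2 + 4 * (L * R) ^ 4) + 6 * h D + 1056 * indicator B D"
      if D: "D \<in> space ?Q" for D
    proof (cases "D \<in> B")
      case True
      \<comment> \<open>Here \<open>32 + 32\<^sup>2 = 1056\<close>.\<close>
      have "a D + (b D)\<^sup>2 \<le> ennreal 32 + (ennreal 32)\<^sup>2"
        using a_bad b_bad by (intro add_mono power_mono) auto
      also have "\<dots> = 1056" by (simp add: ennreal_power)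
      finally have "a D + (b D)\<^sup>2 \<le> 1056 * indicator B D" using True by simp
      also have "\<dots> \<le> (ennreal (8 * \<epsilon>\<^sup>2 + 4 * (L * R) ^ 4) + 6 * h D) + 1056 * indicator B D"
        by (rule add_increasing) auto
      finally show ?thesis .
    next
      case False
      have "a D + (b D)\<^sup>2 \<le> (ennreal (8 * \<epsilon>\<^sup>2) + 6 * h D) + (ennreal (2 * (L * R)\<^sup>2))\<^sup>2"
        using l2[OF f good[OF D False]] b_good[OF D False]
        unfolding a_def h_def by (intro add_mono power_mono) auto
      also have "(ennreal (2 * (L * R)\<^sup>2))\<^sup>2 = ennreal (4 * (L * R) ^ 4)"
        by (simp add: ennreal_power power_mult_distrib flip: power_mult)
      also have "ennreal (8 * \<epsilon>\<^sup>2) + 6 * h D + ennreal (4 * (L * R) ^ 4) = ennreal (8 * \<epsilon>\<^sup>2 + 4 * (L * R) ^ 4) + 6 * h D"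
        by (simp add: add_ac)
      finally show ?thesis using False by simp
    qed
    have hm: "h \<in> borel_measurable ?Q"
      unfolding h_def measurable_cong_sets[OF sets_data_law refl]
      by (rule measurable_L2_norm_histogram(2)[OF p \<A> fm])
    let ?b = "real (card \<A>) * (2 * (1 + \<sigma>\<^sup>2)) / n + 2 * (L * d)\<^sup>2"
    have b0: "0 \<le> ?b" by simp
    have hint: "(\<integral>\<^sup>+D. h D \<partial>?Q) \<le> 2 * ennreal ?b"
    proof -
      have m: "(\<lambda>D. \<integral>\<^sup>+x. ennreal (((?H D x - f x) $ j)\<^sup>2) \<partial>?P) \<in> borel_measurable ?Q" for j
      proof -
        have [measurable_cong]: "sets (?Q \<Otimes>\<^sub>M ?P) = sets (data_space n \<Otimes>\<^sub>M restrict_space borel square)"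
          by (intro sets_pair_measure_cong sets_data_law sets_design_law)
        have [measurable]: "(\<lambda>z. ?H (fst z) (snd z) $ j) \<in> borel_measurable (?Q \<Otimes>\<^sub>M ?P)"
          using measurable_histogram[OF \<A>, of p n j] by (simp add: case_prod_unfold cong: measurable_cong_sets)
        note [measurable] = fm
        show ?thesis
          by (intro P.borel_measurable_nn_integral) (simp add: case_prod_unfold, measurable)
      qed
      have "(\<integral>\<^sup>+D. h D \<partial>?Q) = (\<Sum>j\<in>UNIV. \<integral>\<^sup>+D. \<integral>\<^sup>+x. ennreal (((?H D x - f x) $ j)\<^sup>2) \<partial>?P \<partial>?Q)"
        unfolding h_def L2_norm_power2 by (rule nn_integral_sum) (rule m)
      also have "\<dots> \<le> (\<Sum>j\<in>(UNIV::2 set). ennreal ?b)"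
        using histogram_risk_le[OF p \<sigma> n fm fsq[OF f] fL _ \<A>] L by (intro sum_mono) simp
      finally show ?thesis by simp
    qed
    have "inverse_risk (\<lambda>z. z ^ 4) c p \<sigma> n g f = (\<integral>\<^sup>+D. a D + (b D)\<^sup>2 \<partial>?Q)"
      by (simp add: inverse_risk_def a_def b_def flip: power_mult)
    also have "\<dots> \<le> (\<integral>\<^sup>+D. ennreal (8 * \<epsilon>\<^sup>2 + 4 * (L * R) ^ 4) + 6 * h D + 1056 * indicator B D \<partial>?Q)"
      by (intro nn_integral_mono pointwise)
    also have "\<dots> = ennreal (8 * \<epsilon>\<^sup>2 + 4 * (L * R) ^ 4) + 6 * (\<integral>\<^sup>+D. h D \<partial>?Q) + 1056 * emeasure ?Q B"
      using hm Bm Q.emeasure_space_1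
      by (simp add: nn_integral_add nn_integral_cmult del: ennreal_plus space_data_law)
    also have "\<dots> \<le> ennreal (8 * \<epsilon>\<^sup>2 + 4 * (L * R) ^ 4) + 6 * (2 * ennreal ?b) + 1056 * ennreal ((1/2) ^ K)"
      using hint Bbound by (intro add_mono mult_left_mono) auto
    also have "\<dots> = ennreal (8 * \<epsilon>\<^sup>2 + 4 * (L * R) ^ 4 + 12 * ?b + 1056 * (1/2) ^ K)"
    proof -
      have "6 * (2 * ennreal ?b) = ennreal (12 * ?b)"
        using b0 by (subst ennreal_mult) (auto simp: mult.assoc[symmetric] simp del: ennreal_plus)
      moreover have "1056 * ennreal ((1/2) ^ K) = ennreal (1056 * (1/2) ^ K)"
        by (subst ennreal_mult) auto
      ultimately show ?thesis using b0 by (simp only:) (simp flip: ennreal_plus)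
    qed
    finally show "inverse_risk (\<lambda>z. z ^ 4) c p \<sigma> n g f \<le> ennreal (8 * \<epsilon>\<^sup>2 + 4 * (L * (4 * r + 2 * \<epsilon>)) ^ 4 + 12 * ?b + 1056 * (1/2) ^ K)"
      unfolding R_def .
  qed
qed

section \<open>Non-estimability without a common Lipschitz constant\<close>

text \<open>Both data laws are images of the same law of covariates and noise. The two images
  coincide unless some covariate falls into \<open>A\<close>, and the union bound over the
  \<open>n\<close> covariates gives the additional term.\<close>

lemma data_law_coupling:
  assumes p: "design_density p" and \<sigma>: "0 < \<sigma>"
    and f: "f \<in> borel_measurable (restrict_space borel square)"
    and g: "g \<in> borel_measurable (restrict_space borel square)"
    and A: "A \<in> sets (restrict_space borel square)" "\<And>x. x \<in> square \<Longrightarrow> x \<notin> A \<Longrightarrow> f x = g x"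
    and S: "S \<in> sets (data_space n)"
  shows "measure (data_law p \<sigma> n f) S \<le> measure (data_law p \<sigma> n g) S + n * measure (design_law p) A"
proof -
  let ?PN = "design_law p \<Otimes>\<^sub>M noise_law \<sigma>"
  let ?\<Omega> = "PiM {..<n} (\<lambda>_. ?PN)"
  define T where "T h = (\<lambda>(x, e). (x, h x + e))" for h :: "real^2 \<Rightarrow> real^2"
  interpret d: prob_space "design_law p" using p by (rule prob_space_design_law)
  interpret e: prob_space "noise_law \<sigma>" using \<sigma> by (rule prob_space_noise_law)
  interpret PN: prob_space ?PN using p \<sigma> by (rule prob_space_pair_design_noise)
  interpret \<Omega>: prob_space ?\<Omega> by (intro prob_space_PiM PN.prob_space_axioms)
  have law: "data_law p \<sigma> n h = distr ?\<Omega> (data_law p \<sigma> n h) (compose {..<n} (T h))"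
    and meas: "compose {..<n} (T h) \<in> measurable ?\<Omega> (data_space n)"
    if h: "h \<in> borel_measurable (restrict_space borel square)" for h
  proof -
    have Tm: "T h \<in> measurable ?PN obs_space"
      unfolding T_def by (rule measurable_obs_map[OF h])
    then have "T h \<in> measurable ?PN (obs_law p \<sigma> h)" by (simp cong: measurable_cong_sets)
    then have "distr ?\<Omega> (PiM {..<n} (\<lambda>_. obs_law p \<sigma> h)) (compose {..<n} (T h))
        = PiM {..<n} (\<lambda>_. distr ?PN (obs_law p \<sigma> h) (T h))"
      using prob_space_obs_law[OF p \<sigma> h] by (intro distr_PiM_finite_prob_space' PN.prob_space_axioms) auto
    also have "distr ?PN (obs_law p \<sigma> h) (T h) = obs_law p \<sigma> h"
      unfolding obs_law_def T_def[symmetric] by (intro distr_cong) auto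
    finally show "data_law p \<sigma> n h = distr ?\<Omega> (data_law p \<sigma> n h) (compose {..<n} (T h))"
      by (simp add: data_law_def)
    show "compose {..<n} (T h) \<in> measurable ?\<Omega> (data_space n)"
      unfolding data_space_def compose_def
      by (intro measurable_restrict measurable_compose[OF _ Tm] measurable_component_singleton)
  qed
  have ms: "measure (data_law p \<sigma> n h) S = \<Omega>.prob (compose {..<n} (T h) -` S \<inter> space ?\<Omega>)"
    "compose {..<n} (T h) -` S \<inter> space ?\<Omega> \<in> sets ?\<Omega>"
    if h: "h \<in> borel_measurable (restrict_space borel square)" for h
  proof -
    show "measure (data_law p \<sigma> n h) S = \<Omega>.prob (compose {..<n} (T h) -` S \<inter> space ?\<Omega>)"
      using meas[OF h] S by (subst law[OF h], subst measure_distr) (auto cong: measurable_cong_sets)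
    show "compose {..<n} (T h) -` S \<inter> space ?\<Omega> \<in> sets ?\<Omega>"
      using meas[OF h] S by (rule measurable_sets)
  qed
  define E where "E i = (\<lambda>\<omega>. \<omega> i) -` (A \<times> UNIV) \<inter> space ?\<Omega>" for i
  have Ad: "A \<in> sets (design_law p)" using A(1) by (simp add: sets_design_law)
  have AU: "A \<times> UNIV \<in> sets ?PN" using Ad by (intro pair_measureI) auto
  have E: "E i \<in> sets ?\<Omega>" "\<Omega>.prob (E i) = d.prob A" if "i < n" for i
  proof -
    have m: "(\<lambda>\<omega>. \<omega> i) \<in> measurable ?\<Omega> ?PN"
      using that by (intro measurable_component_singleton) simp
    show "E i \<in> sets ?\<Omega>" unfolding E_def by (rule measurable_sets[OF m AU])
    have "distr ?\<Omega> ?PN (\<lambda>\<omega>. \<omega> i) = ?PN"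
      using that by (intro distr_PiM_component PN.prob_space_axioms) simp
    then have "\<Omega>.prob (E i) = PN.prob (A \<times> UNIV)"
      using measure_distr[OF m AU] by (simp add: E_def)
    also have "\<dots> = d.prob A"
      using e.emeasure_pair_measure_Times[OF Ad, of UNIV] e.emeasure_space_1 by (simp add: measure_def)
    finally show "\<Omega>.prob (E i) = d.prob A" .
  qed
  have "compose {..<n} (T f) -` S \<inter> space ?\<Omega> \<subseteq> (compose {..<n} (T g) -` S \<inter> space ?\<Omega>) \<union> (\<Union>i<n. E i)"
  proof (intro subsetI UnCI)
    fix \<omega> assume w: "\<omega> \<in> compose {..<n} (T f) -` S \<inter> space ?\<Omega>" "\<omega> \<notin> (\<Union>i<n. E i)"
    have "T f (\<omega> i) = T g (\<omega> i)" if "i < n" for i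
    proof -
      have "\<omega> i \<in> space ?PN" using w(1) that by (auto simp: space_PiM)
      then have "fst (\<omega> i) \<in> square" by (auto simp: space_pair_measure)
      moreover have "fst (\<omega> i) \<notin> A" using w that by (auto simp: E_def mem_Times_iff)
      ultimately show ?thesis using A(2) by (simp add: T_def case_prod_unfold)
    qed
    then have "compose {..<n} (T f) \<omega> = compose {..<n} (T g) \<omega>" by (auto simp: compose_def)
    then show "\<omega> \<in> compose {..<n} (T g) -` S \<inter> space ?\<Omega>" using w(1) by simp
  qed
  then have "\<Omega>.prob (compose {..<n} (T f) -` S \<inter> space ?\<Omega>)
      \<le> \<Omega>.prob ((compose {..<n} (T g) -` S \<inter> space ?\<Omega>) \<union> (\<Union>i<n. E i))"
    using ms(2)[OF g] E(1) by (intro \<Omega>.finite_measure_mono) auto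
  also have "\<dots> \<le> \<Omega>.prob (compose {..<n} (T g) -` S \<inter> space ?\<Omega>) + \<Omega>.prob (\<Union>i<n. E i)"
    using ms(2)[OF g] E(1) by (intro measure_Un_le) auto
  also have "\<Omega>.prob (\<Union>i<n. E i) \<le> (\<Sum>i<n. \<Omega>.prob (E i))"
    using E(1) by (intro \<Omega>.finite_measure_subadditive_finite) auto
  also have "\<dots> = n * d.prob A" using E(2) by simp
  finally show ?thesis using ms(1)[OF f] ms(1)[OF g] by simp
qed

text \<open>In the first coordinate this is a piecewise linear bijection of \<open>[-1,1]\<close>
  with slope \<open>a\<close> up to the kink and slope 1/2 after it. The second line does not depend
  on \<open>a\<close>: maps with different \<open>a\<close> agree outside a thin strip at the left
  edge, in which each rises from -1 to slightly above 0.\<close>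

definition steep :: "real \<Rightarrow> real^2 \<Rightarrow> real^2" where
  "steep a x = (\<chi> j. if j = 1 then min (a * (x $ 1 + 1) - 1) ((x $ 1 + 1) / 2) else x $ j)"

lemma steep_nth [simp]:
  "steep a x $ 1 = min (a * (x $ 1 + 1) - 1) ((x $ 1 + 1) / 2)" "steep a x $ 2 = x $ 2"
  by (simp_all add: steep_def)

lemma norm_power2_vec2: "(norm (x :: real^2))\<^sup>2 = (x $ 1)\<^sup>2 + (x $ 2)\<^sup>2"
  unfolding power2_norm_eq_inner inner_vec_def by (simp add: sum_2 power2_eq_square)

text \<open>The inverse \<open>w\<close> is explicit: the minimum of two increasing lines is
  inverted by the maximum of their inverses. All slopes lie between 1/2 and \<open>a\<close>, and
  \<open>a \<ge> 2\<close> makes \<open>a\<close> serve as constant in both directions and for the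
  unchanged second coordinate.\<close>

lemma steep_F_INV_Lip:
  assumes a: "2 \<le> a"
  shows "steep a \<in> F_INV_Lip \<infinity>"
proof -
  define v where "v t = min (a * (t + 1) - 1) ((t + 1) / 2)" for t
  define w where "w y = max ((y + 1) / a - 1) (2 * y - 1)" for y
  have vw: "v (w y) = y" for y
  proof -
    have P: "a * (((y + 1) / a - 1) + 1) - 1 = y" using a by simp
    have mono: "s \<le> t \<Longrightarrow> a * (s + 1) - 1 \<le> a * (t + 1) - 1" for s t using a by simp
    show ?thesis
      using P mono[of "(y + 1) / a - 1" "2 * y - 1"] by (auto simp: v_def w_def max_def min_def)
  qed
  have wv: "w (v t) = t" for t
  proof -
    define A B where "A = a * (t + 1) - 1" and "B = (t + 1) / 2"
    have A: "(A + 1) / a - 1 = t" and B: "2 * B - 1 = t" using a by (simp add: A_def) (simp add: B_def field_simps)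
    have "w (min A B) = t"
    proof (cases "A \<le> B")
      case True
      then show ?thesis using A B by (simp add: w_def)
    next
      case False
      then have "(B + 1) / a \<le> (A + 1) / a" using a by (simp add: divide_right_mono)
      then show ?thesis using False A B by (simp add: w_def min_def)
    qed
    then show ?thesis by (simp add: v_def A_def B_def)
  qed
  have incr: "(t - s) / 2 \<le> v t - v s \<and> v t - v s \<le> a * (t - s)" if "s \<le> t" for s t
  proof -
    have "2 * (t - s) \<le> a * (t - s)" using a that by (intro mult_right_mono) auto
    moreover have "a * (t + 1) - 1 - (a * (s + 1) - 1) = a * (t - s)" by (simp add: algebra_simps)
    moreover obtain q where q: "q = a * (t - s)" by blast
    ultimately have slope: "2 * (t - s) \<le> q" by simp
    have e1: "a * (t + 1) - 1 - (a * (s + 1) - 1) = q" by (simp add: q algebra_simps)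
    have e2: "(t + 1) / 2 - (s + 1) / 2 = (t - s) / 2" by (simp add: field_simps)
    \<comment> \<open>Bounds on increments pass to the minimum of two functions, so no case
      distinction at the kink is needed.\<close>
    have min_diff: "m \<le> min A' B' - min A B \<and> min A' B' - min A B \<le> M"
      if "m \<le> A' - A" "A' - A \<le> M" "m \<le> B' - B" "B' - B \<le> M" for A A' B B' m M :: real
      using that by (auto simp: min_def)
    show ?thesis unfolding v_def q[symmetric]
    proof (rule min_diff)
      have "(t - s) / 2 \<le> 2 * (t - s)" using that by (simp add: field_simps)
      also note slope
      finally have "(t - s) / 2 \<le> q" .
      then show "(t - s) / 2 \<le> a * (t + 1) - 1 - (a * (s + 1) - 1)" "(t + 1) / 2 - (s + 1) / 2 \<le> q"
        unfolding e1 e2 by blast+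
    qed (use e1 e2 in linarith)+
  qed
  have v1: "\<bar>v t\<bar> \<le> 1" if "\<bar>t\<bar> \<le> 1" for t
  proof -
    have "v (-1) = -1" "v 1 = 1" using a by (auto simp: v_def)
    then show ?thesis using incr[of "-1" t] incr[of t 1] that by (simp add: abs_le_iff)
  qed
  have w1: "\<bar>w y\<bar> \<le> 1" if y: "\<bar>y\<bar> \<le> 1" for y
  proof -
    have "(y + 1) / a \<le> 2" "0 \<le> (y + 1) / a" using a y by (auto simp: field_simps abs_le_iff)
    then show ?thesis using y by (auto simp: w_def max_def abs_le_iff)
  qed
  have lip: "\<bar>t - s\<bar> / 2 \<le> \<bar>v t - v s\<bar> \<and> \<bar>v t - v s\<bar> \<le> a * \<bar>t - s\<bar>" for s t
    using incr[of s t] incr[of t s] by (cases "s \<le> t") (auto simp: abs_if)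
  have sv: "steep a x $ 1 = v (x $ 1)" for x by (simp add: v_def)
  have 1: "steep a ` square \<subseteq> square"
    using v1 by (auto simp: mem_square_iff forall_2 sv simp del: steep_nth(1))
  have 2: "\<exists>!x. x \<in> square \<and> steep a x = y" if y: "y \<in> square" for y
  proof (intro ex1I conjI)
    let ?x = "(\<chi> j. if j = 1 then w (y $ 1) else y $ j) :: real^2"
    show "?x \<in> square" using y w1 by (simp add: mem_square_iff forall_2)
    show "steep a ?x = y" by (simp add: vec_eq_iff forall_2 sv vw del: steep_nth(1))
    show "x = ?x" if "x \<in> square \<and> steep a x = y" for x
      using that wv[of "x $ 1"] by (auto simp: vec_eq_iff forall_2 sv simp del: steep_nth(1))
  qed
  have "bi_Lipschitz_on a square (steep a)"
    unfolding bi_Lipschitz_on_def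
  proof (intro ballI conjI)
    fix x x' :: "real^2"
    let ?d1 = "x $ 1 - x' $ 1" and ?d2 = "x $ 2 - x' $ 2" and ?e = "v (x $ 1) - v (x' $ 1)"
    have n: "(norm (x - x'))\<^sup>2 = ?d1\<^sup>2 + ?d2\<^sup>2" "(norm (steep a x - steep a x'))\<^sup>2 = ?e\<^sup>2 + ?d2\<^sup>2"
      by (simp_all add: norm_power2_vec2 sv del: steep_nth(1))
    have "\<bar>?e\<bar>\<^sup>2 \<le> (a * \<bar>?d1\<bar>)\<^sup>2" using lip[of "x $ 1" "x' $ 1"] by (intro power_mono) auto
    then have e1: "?e\<^sup>2 \<le> a\<^sup>2 * ?d1\<^sup>2" by (simp add: power_mult_distrib)
    have "(\<bar>?d1\<bar> / 2)\<^sup>2 \<le> \<bar>?e\<bar>\<^sup>2" using lip[of "x $ 1" "x' $ 1"] by (intro power_mono) auto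
    then have e2: "?d1\<^sup>2 / 4 \<le> ?e\<^sup>2" by (simp add: power_divide)
    have a4: "4 \<le> a\<^sup>2" using power_mono[OF a, of 2] by simp
    have d2: "?d2\<^sup>2 \<le> a\<^sup>2 * ?d2\<^sup>2" using mult_right_mono[of 1 "a\<^sup>2" "?d2\<^sup>2"] a4 by simp
    have "(norm (steep a x - steep a x'))\<^sup>2 \<le> (a * norm (x - x'))\<^sup>2"
      using add_mono[OF e1 d2] by (simp add: n power_mult_distrib distrib_left)
    then show "norm (steep a x - steep a x') \<le> a * norm (x - x')"
      using a by (intro power2_le_imp_le[of "norm (steep a x - steep a x')"]) auto
    have "norm (x - x') \<le> a * norm (steep a x - steep a x')"
    proof (rule power2_le_imp_le)
      have "?d1\<^sup>2 \<le> 4 * ?e\<^sup>2" using e2 by simp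
      also have "\<dots> \<le> a\<^sup>2 * ?e\<^sup>2" using a4 by (intro mult_right_mono) auto
      finally show "(norm (x - x'))\<^sup>2 \<le> (a * norm (steep a x - steep a x'))\<^sup>2"
        using d2 by (simp add: n power_mult_distrib distrib_left)
    qed (use a in auto)
    then show "inverse a * norm (x - x') \<le> norm (steep a x - steep a x')"
      using a by (simp add: field_simps)
  qed
  then show ?thesis using 1 2 a unfolding F_INV_Lip_def by (auto intro!: exI[of _ a])
qed

text \<open>The hypothesis puts \<open>x\<close> to the right of the kink of \<open>steep a\<close>.
  The line of slope \<open>2 * a\<close> is higher still, so both minima are attained by the common
  line.\<close>

lemma steep_eq_off_strip:
  assumes "2 \<le> a" "1 < (a - 1/2) * (x $ 1 + 1)"
  shows "steep a x = steep (2 * a) x"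
proof -
  have "(x $ 1 + 1) / 2 \<le> a * (x $ 1 + 1) - 1" using assms(2) by (simp add: algebra_simps)
  moreover have "0 \<le> x $ 1 + 1"
    using assms mult_nonneg_nonpos[of "a - 1/2" "x $ 1 + 1"] by linarith
  then have "a * (x $ 1 + 1) \<le> 2 * a * (x $ 1 + 1)" using assms(1) by (intro mult_right_mono) auto
  ultimately show ?thesis by (simp add: vec_eq_iff forall_2)
qed

lemma steep_separated:
  assumes a: "2 \<le> a"
  obtains x where "x \<in> square" "1/2 \<le> norm (steep a x - steep (2 * a) x)"
proof
  \<comment> \<open>The kink of \<open>steep (2 * a)\<close> is at distance \<open>s\<close> from
    the left edge. There this map has the value \<open>s / 2\<close>, while \<open>steep a\<close>
    has reached only \<open>s / 4 - 1/2\<close>.\<close>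
  define s where "s = 1 / (2 * a - 1/2)"
  define x :: "real^2" where "x = (\<chi> j. if j = 1 then s - 1 else 0)"
  have s: "2 * a * s = 1 + s / 2" "0 < s" "s \<le> 1" using a by (auto simp: s_def field_simps)
  show "x \<in> square" using s by (simp add: mem_square_iff forall_2 x_def)
  have "1/2 \<le> \<bar>(steep a x - steep (2 * a) x) $ 1\<bar>"
    using s by (auto simp: x_def min_def abs_if)
  also have "\<dots> \<le> norm (steep a x - steep (2 * a) x)" by (rule component_le_norm_cart)
  finally show "1/2 \<le> norm (steep a x - steep (2 * a) x)" .
qed

lemma measure_design_law_strip:
  assumes p: "design_density p" and \<eta>: "0 < \<eta>"
  obtains a where "2 \<le> a" "measure (design_law p) {x \<in> square. (a - 1/2) * (x $ 1 + 1) \<le> 1} \<le> \<eta>"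
    "{x \<in> square. (a - 1/2) * (x $ 1 + 1) \<le> 1} \<in> sets (restrict_space borel square)"
proof -
  obtain M0 where M0: "\<And>x. x \<in> square \<Longrightarrow> p x \<le> M0" using p by (auto simp: design_density_def)
  define M where "M = max 1 M0"
  have M: "1 \<le> M" "\<And>x. x \<in> square \<Longrightarrow> p x \<le> M" using M0 by (auto simp: M_def le_max_iff_disj)
  \<comment> \<open>The strip has width \<open>s\<close> and height 2, hence mass at most
    \<open>2 * M * s\<close>; the choice makes \<open>a - 1/2\<close> at least
    \<open>2 * M / \<eta>\<close>, so this mass is at most \<open>\<eta>\<close>. The summand 2
    provides \<open>2 \<le> a\<close>, and \<open>M \<ge> 1\<close> keeps the divisions
    legitimate.\<close>
  define a where "a = 2 + 2 * M / \<eta>"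
  define s where "s = 1 / (a - 1/2)"
  have a: "2 \<le> a" using M \<eta> by (simp add: a_def)
  have s0: "0 < s" using a by (simp add: s_def)
  have "2 * M / \<eta> \<le> a - 1/2" by (simp add: a_def)
  then have "s \<le> 1 / (2 * M / \<eta>)" unfolding s_def using M \<eta> a by (intro divide_left_mono) auto
  then have s: "M * (2 * s) \<le> \<eta>" using M \<eta> by (simp add: field_simps)
  let ?A = "{x \<in> square. (a - 1/2) * (x $ 1 + 1) \<le> 1}"
  have sq: "square \<in> sets borel" by (simp add: square_def)
  have Ab: "?A \<in> sets borel"
  proof -
    have "{x :: real^2 \<in> space borel. (a - 1/2) * (x $ 1 + 1) \<le> 1} \<in> sets borel" by measurable
    then have "square \<inter> {x. (a - 1/2) * (x $ 1 + 1) \<le> 1} \<in> sets borel" using sq by auto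
    then show ?thesis by (simp add: Int_def)
  qed
  have A: "?A \<in> sets (restrict_space borel square)"
    using sq Ab by (subst sets_restrict_space_iff) auto
  have A': "?A \<in> sets (restrict_space lborel square)"
    using sq Ab by (subst sets_restrict_space_iff) auto
  define lo hi :: "real^2" where "lo = (\<chi> j. -1)" and "hi = (\<chi> j. if j = 1 then s - 1 else 1)"
  have "?A \<subseteq> cbox lo hi"
  proof
    fix x assume x: "x \<in> ?A"
    then have "x $ 1 + 1 \<le> s" using a by (simp add: s_def field_simps)
    then show "x \<in> cbox lo hi"
      using x by (auto simp: mem_box_cart forall_2 lo_def hi_def mem_square_iff abs_le_iff)
  qed
  then have "emeasure lborel ?A \<le> emeasure lborel (cbox lo hi)" by (intro emeasure_mono) auto
  also have "\<dots> = ennreal (measure lborel (cbox lo hi))"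
    by (intro emeasure_eq_ennreal_measure) (use emeasure_lborel_cbox_finite[of lo hi] in auto)
  also have "measure lborel (cbox lo hi) = 2 * s"
  proof -
    have "lo \<in> cbox lo hi" using s0 by (simp add: mem_box_cart forall_2 lo_def hi_def)
    then have "cbox lo hi \<noteq> {}" by blast
    then show ?thesis by (subst content_cbox_cart) (simp_all add: lo_def hi_def UNIV_2)
  qed
  finally have vol: "emeasure lborel ?A \<le> ennreal (2 * s)" .
  have "emeasure (design_law p) ?A = (\<integral>\<^sup>+x. ennreal (p x) * indicator ?A x \<partial>restrict_space lborel square)"
    unfolding design_law_def using measurable_design_density[OF p] A' by (intro emeasure_density) auto
  also have "\<dots> \<le> (\<integral>\<^sup>+x. ennreal M * indicator ?A x \<partial>restrict_space lborel square)"
    using M by (intro nn_integral_mono mult_right_mono ennreal_leI) (auto simp: space_restrict_space)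
  also have "\<dots> = ennreal M * emeasure (restrict_space lborel square) ?A"
    using A' by (rule nn_integral_cmult_indicator)
  also have "emeasure (restrict_space lborel square) ?A = emeasure lborel ?A"
    using sq by (intro emeasure_restrict_space) auto
  also have "ennreal M * emeasure lborel ?A \<le> ennreal M * ennreal (2 * s)" using vol by (rule mult_left_mono) simp
  also have "\<dots> = ennreal (M * (2 * s))" using M s0 by (simp add: ennreal_mult)
  also have "\<dots> \<le> ennreal \<eta>" using s by (rule ennreal_leI)
  finally have "measure (design_law p) ?A \<le> \<eta>" using \<eta> by (simp add: measure_def enn2real_leI)
  then show thesis by (rule that[OF a _ A])
qed

section \<open>Rates\<close>

text \<open>A two-point argument at a fixed sample size. The maps \<open>steep a\<close> and
  \<open>steep (2 * a)\<close> differ by at least 1/2 somewhere, so for \<open>4 * r < 1/2\<close>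
  no data set serves both. Yet with \<open>a\<close> large enough for \<open>n\<close>, the event
  that serves the first map keeps, under the law of the second, probability above
  \<open>1 - \<delta> - 1/4\<close>. Two disjoint events would then have total probability above
  \<open>2 - 2 * \<delta> - 1/4\<close>, which exceeds 1.\<close>

lemma not_uniformly_estimable_F_INV_Lip_infinity:
  assumes p: "design_density p" and \<sigma>: "0 < \<sigma>" and r: "0 \<le> r" "r < 1/8" and \<delta>: "\<delta> \<le> 1/4"
  shows "\<exists>f\<in>F_INV_Lip \<infinity>. Linf_error_prob p \<sigma> n fh f r < 1 - \<delta>"
proof (rule ccontr)
  assume "\<not> ?thesis"
  then have prob: "1 - \<delta> \<le> Linf_error_prob p \<sigma> n fh f r" if "f \<in> F_INV_Lip \<infinity>" for f
    using that by (meson not_less)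
  \<comment> \<open>Taking \<open>n + 1\<close> covers \<open>n = 0\<close> and makes the union
    bound strictly smaller than 1/4.\<close>
  have "0 < 1 / (4 * (real n + 1))" by simp
  then obtain a where a: "2 \<le> a"
    "measure (design_law p) {x \<in> square. (a - 1/2) * (x $ 1 + 1) \<le> 1} \<le> 1 / (4 * (real n + 1))"
    "{x \<in> square. (a - 1/2) * (x $ 1 + 1) \<le> 1} \<in> sets (restrict_space borel square)"
    by (rule measure_design_law_strip[OF p])
  let ?A = "{x \<in> square. (a - 1/2) * (x $ 1 + 1) \<le> 1}"
  define f g where "f = steep a" and "g = steep (2 * a)"
  have f: "f \<in> F_INV_Lip \<infinity>" and g: "g \<in> F_INV_Lip \<infinity>"
    using steep_F_INV_Lip a by (auto simp: f_def g_def)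
  interpret Q: prob_space "data_law p \<sigma> n g"
    using prob_space_data_law[OF p \<sigma> F_INV_Lip_measurable[OF g]] .
  have pos: "0 < 1 - \<delta>" using \<delta> by simp
  obtain S where S: "S \<in> sets (data_law p \<sigma> n f)" "1 - \<delta> \<le> measure (data_law p \<sigma> n f) S"
      "\<And>D. D \<in> S \<Longrightarrow> Linf_norm (\<lambda>x. fh D x - f x) \<le> ennreal r"
    using Linf_error_prob_inner[OF prob[OF f] pos] by blast
  obtain S' where S': "S' \<in> sets (data_law p \<sigma> n g)" "1 - \<delta> \<le> measure (data_law p \<sigma> n g) S'"
      "\<And>D. D \<in> S' \<Longrightarrow> Linf_norm (\<lambda>x. fh D x - g x) \<le> ennreal r"
    using Linf_error_prob_inner[OF prob[OF g] pos] by blast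
  obtain x where x: "x \<in> square" "1/2 \<le> norm (f x - g x)"
    unfolding f_def g_def by (rule steep_separated[OF a(1)])
  have disj: "S \<inter> S' = {}"
  proof (intro equals0I)
    fix D assume "D \<in> S \<inter> S'"
    then have "norm (fh D x - f x) \<le> 2 * r" "norm (fh D x - g x) \<le> 2 * r"
      using S(3) S'(3) Linf_norm_leD r(1) x(1) by blast+
    moreover have "norm (f x - g x) \<le> norm (fh D x - g x) + norm (fh D x - f x)"
      using norm_triangle_ineq4[of "fh D x - g x" "fh D x - f x"] by simp
    ultimately show False using x(2) r(2) by simp
  qed
  have Sg: "S \<in> sets (data_law p \<sigma> n g)" using S(1) by simp
  have "f x = g x" if "x \<in> square" "x \<notin> ?A" for x
    using that steep_eq_off_strip[OF a(1), of x] by (simp add: f_def g_def)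
  then have "measure (data_law p \<sigma> n f) S \<le> Q.prob S + n * measure (design_law p) ?A"
    using S(1) a(3) by (intro data_law_coupling[OF p \<sigma>] F_INV_Lip_measurable[OF f] F_INV_Lip_measurable[OF g]) auto
  moreover have "n * measure (design_law p) ?A \<le> n * (1 / (4 * (real n + 1)))"
    using a(2) by (rule mult_left_mono) simp
  moreover have "n * (1 / (4 * (real n + 1))) < 1/4" by (simp add: field_simps)
  ultimately have "1 - \<delta> < Q.prob S + 1/4" using S(2) by linarith
  moreover have "Q.prob S + Q.prob S' \<le> 1"
    using Q.finite_measure_Union[OF Sg S'(1) disj] Q.prob_le_1[of "S \<union> S'"] by simp
  ultimately show False using S'(2) \<delta> by simp
qed

section \<open>From the number of blocks to the rate\<close>

lemma risk_terms_le:
  fixes k n :: nat and L r \<sigma> :: real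
  assumes k: "1 \<le> k" "k\<^sup>2 \<le> 2 ^ k" and n: "k ^ 4 \<le> n" and L: "1 \<le> L"
    and r: "0 \<le> r" "r \<le> real k powr (- (1/2))" and N: "N \<le> 9 * k\<^sup>2"
  shows "8 * (1 / real k)\<^sup>2 + 4 * (L * (4 * r + 2 * (1 / real k))) ^ 4
        + 12 * (real N * (2 * (1 + \<sigma>\<^sup>2)) / n + 2 * (L * (2 / real k))\<^sup>2) + 1056 * (1/2) ^ k
    \<le> (1064 + 5184 * L ^ 4 + 216 * (1 + \<sigma>\<^sup>2) + 96 * L\<^sup>2) / (real k)\<^sup>2"
proof -
  let ?s = "real k powr (- (1/2))"
  have k0: "0 < real k" using k by simp
  have s: "?s ^ 4 = 1 / (real k)\<^sup>2" "1 / real k \<le> ?s" "0 \<le> ?s"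
  proof -
    have "?s = 1 / sqrt (real k)" using k0 unfolding powr_minus_divide by (simp add: powr_half_sqrt)
    moreover have "sqrt (real k) ^ 4 = ((sqrt (real k))\<^sup>2)\<^sup>2" by (simp only: power_mult[symmetric]) simp
    ultimately show "?s ^ 4 = 1 / (real k)\<^sup>2" by (simp only: power_divide power_one) simp
    have "1 / real k = real k powr (- 1)" using k0 by (simp add: powr_minus divide_inverse)
    also have "\<dots> \<le> ?s" using k by (intro powr_mono) auto
    finally show "1 / real k \<le> ?s" .
  qed simp
  \<comment> \<open>All uniform errors are measured by \<open>?s\<close>, whose fourth power is
    exactly the target \<open>1 / (real k)\<^sup>2\<close>. The factor 6 yields
    \<open>4 * 6 ^ 4 = 5184\<close>; the other constants are \<open>8 + 1056 = 1064\<close>,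
    \<open>12 * 18 = 216\<close> and \<open>12 * 2 * 4 = 96\<close>.\<close>
  have "4 * r + 2 * (1 / real k) \<le> 6 * ?s" using r(2) s(2) by linarith
  then have "L * (4 * r + 2 * (1 / real k)) \<le> L * (6 * ?s)" using L by (intro mult_left_mono) simp_all
  moreover have "0 \<le> L * (4 * r + 2 * (1 / real k))" using r(1) L k0 by simp
  ultimately have "(L * (4 * r + 2 * (1 / real k))) ^ 4 \<le> (L * (6 * ?s)) ^ 4" by (rule power_mono)
  also have "\<dots> = 1296 * L ^ 4 / (real k)\<^sup>2" by (simp add: power_mult_distrib s(1))
  finally have 1: "4 * (L * (4 * r + 2 * (1 / real k))) ^ 4 \<le> 5184 * L ^ 4 / (real k)\<^sup>2" by simp
  have "real N * (2 * (1 + \<sigma>\<^sup>2)) / n \<le> (9 * (real k)\<^sup>2) * (2 * (1 + \<sigma>\<^sup>2)) / real (k ^ 4)"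
  proof (intro frac_le mult_right_mono)
    show "real N \<le> 9 * (real k)\<^sup>2" using of_nat_mono[OF N, where 'a=real] by simp
    show "real (k ^ 4) \<le> real n" using n by (rule of_nat_mono)
    show "0 < real (k ^ 4)" using k0 by simp
  qed auto
  also have "real (k ^ 4) = (real k)\<^sup>2 * (real k)\<^sup>2" by (simp flip: power_add)
  also have "(9 * (real k)\<^sup>2) * (2 * (1 + \<sigma>\<^sup>2)) / ((real k)\<^sup>2 * (real k)\<^sup>2) = 18 * (1 + \<sigma>\<^sup>2) / (real k)\<^sup>2"
  proof -
    have "(9 * q) * (2 * w) / (q * q) = 18 * w / q" if "q \<noteq> 0" for q w :: real
      using that by (simp add: field_simps)
    from this[of "(real k)\<^sup>2" "1 + \<sigma>\<^sup>2"] show ?thesis using k0 by fastforce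
  qed
  finally have 2: "real N * (2 * (1 + \<sigma>\<^sup>2)) / n \<le> 18 * (1 + \<sigma>\<^sup>2) / (real k)\<^sup>2" .
  have 3: "(L * (2 / real k))\<^sup>2 = 4 * L\<^sup>2 / (real k)\<^sup>2" by (simp add: power_mult_distrib power_divide)
  have "(real k)\<^sup>2 \<le> 2 ^ k" using k(2) by (metis of_nat_le_iff of_nat_numeral of_nat_power)
  then have 4: "(1/2) ^ k \<le> 1 / (real k)\<^sup>2" using k0 frac_le[of 1 1 "(real k)\<^sup>2" "2 ^ k"] by (simp add: power_divide)
  have 5: "(1 / real k)\<^sup>2 = 1 / (real k)\<^sup>2" by (simp add: power_divide)
  have 6: "12 * (real N * (2 * (1 + \<sigma>\<^sup>2)) / n + 2 * (L * (2 / real k))\<^sup>2)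
      \<le> 12 * (18 * (1 + \<sigma>\<^sup>2) / (real k)\<^sup>2 + 2 * (4 * L\<^sup>2 / (real k)\<^sup>2))"
    unfolding 3 by (rule mult_left_mono[OF add_right_mono[OF 2]]) simp
  have 7: "1056 * (1/2) ^ k \<le> 1056 * (1 / (real k)\<^sup>2)" using 4 by (rule mult_left_mono) simp
  have 8: "8 * (1 / real k)\<^sup>2 \<le> 8 * (1 / (real k)\<^sup>2)" unfolding 5 by (rule order_refl)
  note add_mono[OF add_mono[OF add_mono[OF 8 1] 6] 7]
  also have "8 * (1 / (real k)\<^sup>2) + 5184 * L ^ 4 / (real k)\<^sup>2
        + 12 * (18 * (1 + \<sigma>\<^sup>2) / (real k)\<^sup>2 + 2 * (4 * L\<^sup>2 / (real k)\<^sup>2)) + 1056 * (1 / (real k)\<^sup>2)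
      = (1064 + 5184 * L ^ 4 + 216 * (1 + \<sigma>\<^sup>2) + 96 * L\<^sup>2) / (real k)\<^sup>2"
    by (simp add: add_divide_distrib)
  finally show ?thesis .
qed

definition fourth_root_floor :: "nat \<Rightarrow> nat" where
  "fourth_root_floor n = nat \<lfloor>root 4 (real n)\<rfloor>"

text \<open>The first inequality makes \<open>k\<close> blocks of \<open>k ^ 3\<close> observations
  fit into the sample; the second says that rounding down loses only a constant factor when the rate
  in \<open>k\<close> is converted into one in \<open>n\<close>.\<close>

lemma fourth_root_floor_bounds: "fourth_root_floor n ^ 4 \<le> n" "n < (fourth_root_floor n + 1) ^ 4"
proof -
  let ?k = "fourth_root_floor n"
  have r: "root 4 (real n) ^ 4 = real n" by (simp add: real_root_pow_pos2)
  have "real ?k = of_int \<lfloor>root 4 (real n)\<rfloor>" by (simp add: fourth_root_floor_def)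
  then have k: "real ?k \<le> root 4 (real n)" "root 4 (real n) < real ?k + 1" by linarith+
  have "real ?k ^ 4 \<le> root 4 (real n) ^ 4" using k(1) by (intro power_mono) auto
  then show "?k ^ 4 \<le> n" unfolding r by (metis of_nat_le_iff of_nat_power)
  have "root 4 (real n) ^ 4 < (real ?k + 1) ^ 4" using k(2) by (intro power_strict_mono) auto
  then have "real n < real ((?k + 1) ^ 4)" unfolding r by (simp add: add.commute)
  then show "n < (?k + 1) ^ 4" by (rule of_nat_less_imp_less)
qed

lemma filterlim_fourth_root_floor: "filterlim fourth_root_floor at_top sequentially"
proof -
  have "Z \<le> fourth_root_floor n" if "Z ^ 4 \<le> n" for Z n
  proof (rule ccontr)
    assume "\<not> ?thesis"
    then have "(fourth_root_floor n + 1) ^ 4 \<le> Z ^ 4" by (intro power_mono) auto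
    then show False using that fourth_root_floor_bounds(2)[of n] by linarith
  qed
  then show ?thesis unfolding filterlim_at_top eventually_sequentially by blast
qed

lemma inverse_square_le_rate:
  fixes k n :: nat
  assumes k: "1 \<le> k" and n: "n < (k + 1) ^ 4" "3 \<le> n" and \<gamma>: "0 \<le> \<gamma>"
  shows "1 / (real k)\<^sup>2 \<le> 4 * real n powr (- (2 / (2 + 2))) * ln (real n) powr \<gamma>"
proof -
  \<comment> \<open>Bounding \<open>k + 1\<close> by \<open>2 * k\<close> gives
    \<open>sqrt n \<le> 4 * k^2\<close>, the origin of the factor 4. The exponent is left as
    \<open>2 / (2 + 2)\<close> to display the dimension 2; for \<open>n \<ge> 3\<close> the
    logarithm is at least 1.\<close>
  have "(k + 1) ^ 4 \<le> (2 * k) ^ 4" using k by (intro power_mono) auto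
  then have "real n \<le> real ((2 * k) ^ 4)" using n by (intro of_nat_mono) linarith
  also have "\<dots> = (4 * (real k)\<^sup>2)\<^sup>2" by (simp add: power_mult_distrib flip: power_mult)
  finally have "sqrt (real n) \<le> 4 * (real k)\<^sup>2" by (intro real_le_lsqrt) auto
  then have "1 / (real k)\<^sup>2 \<le> 4 * (1 / sqrt (real n))" using k n by (simp add: field_simps)
  also have e: "1 / sqrt (real n) = real n powr (- (2 / (2 + 2)))"
    using n by (simp add: powr_minus_divide powr_half_sqrt)
  also have "4 * real n powr (- (2 / (2 + 2))) \<le> 4 * real n powr (- (2 / (2 + 2))) * ln (real n) powr \<gamma>"
  proof -
    have "exp 1 \<le> real n" using exp_le n(2) by linarith
    then have "1 \<le> ln (real n)" using n by (subst ln_ge_iff) auto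
    then have "1 \<le> ln (real n) powr \<gamma>" using \<gamma> by (rule ge_one_powr_ge_zero)
    from mult_left_mono[OF this, of "4 * real n powr (- (2 / (2 + 2)))"] show ?thesis by simp
  qed
  finally show ?thesis .
qed

theorem corollary9:
  fixes \<Lambda> :: ereal and p :: "real^2 \<Rightarrow> real" and \<sigma> :: real and c :: "real^2"
    and fhat1 :: "nat \<Rightarrow> estimator" and C \<alpha> :: real and \<delta> :: "nat \<Rightarrow> real"
  assumes "1 \<le> \<Lambda>"
    and "design_density p" and "\<sigma> > 0" and "c \<notin> square"
    and "\<And>n. fhat1 n \<in> estimators n"
    and "\<And>n D x. D \<in> space (data_space n) \<Longrightarrow> x \<in> square \<Longrightarrow> fhat1 n D x \<in> square"
    and "C > 0" and "\<alpha> > 0" and "decseq \<delta>" and "\<delta> \<longlonglongrightarrow> 0"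
    and "\<forall>\<^sub>F n in sequentially. \<forall>f\<in>F_INV_Lip \<Lambda>.
           Linf_error_prob p \<sigma> n (fhat1 n) f
             (C * real n powr (- (1 / (2 + 2))) * ln (real n) powr \<alpha>) \<ge> 1 - \<delta> n"
  shows "\<forall>\<beta>>0. \<exists>Cbar>0. \<forall>\<^sub>F n in sequentially.
           (INF g\<in>estimators n. SUP f\<in>F_INV_Lip \<Lambda>. inverse_risk (\<lambda>z. z ^ 4) c p \<sigma> n g f)
             \<le> ennreal (Cbar * real n powr (- (2 / (2 + 2))) * ln (real n) powr (2 * \<alpha> + 2 * \<beta>))"
proof -
  define r where "r n = C * real n powr (- (1 / (2 + 2))) * ln (real n) powr \<alpha>" for n :: nat
  note p = assms(2) and \<sigma> = assms(3)
  have r0: "0 \<le> r n" for n using assms(7) by (simp add: r_def)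
  have hyp: "\<forall>\<^sub>F n in sequentially. \<forall>f\<in>F_INV_Lip \<Lambda>. 1 - \<delta> n \<le> Linf_error_prob p \<sigma> n (fhat1 n) f (r n)"
    using assms(11) by (simp add: r_def)
  have \<delta>: "\<forall>\<^sub>F n in sequentially. \<delta> n \<le> 1/15"
    using order_tendstoD(2)[OF assms(10), of "1/15"] by (auto elim: eventually_mono)
  show ?thesis
  proof (cases \<Lambda>)
    case MInf
    then show ?thesis using assms(1) by simp
  next
    case PInf
    \<comment> \<open>A single sample size at which the assumption holds with both
      \<open>r n\<close> and \<open>\<delta> n\<close> small already contradicts the two-point
      bound.\<close>
    have "\<forall>\<^sub>F n in sequentially. r n < 1/8"
      unfolding r_def using assms(7,8) by real_asymp
    with hyp \<delta> have "\<forall>\<^sub>F n in sequentially. (\<forall>f\<in>F_INV_Lip \<Lambda>. 1 - \<delta> n \<le> Linf_error_prob p \<sigma> n (fhat1 n) f (r n))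
        \<and> \<delta> n \<le> 1/15 \<and> r n < 1/8"
      by (intro eventually_conj)
    then obtain n where n: "\<forall>f\<in>F_INV_Lip \<Lambda>. 1 - \<delta> n \<le> Linf_error_prob p \<sigma> n (fhat1 n) f (r n)"
        "\<delta> n \<le> 1/15" "r n < 1/8"
      by (auto dest!: eventually_happens)
    then have "\<exists>f\<in>F_INV_Lip \<infinity>. Linf_error_prob p \<sigma> n (fhat1 n) f (r n) < 1 - \<delta> n"
      by (intro not_uniformly_estimable_F_INV_Lip_infinity[OF p \<sigma> r0]) auto
    then show ?thesis using n(1) PInf by (auto simp: not_le[symmetric])
  next
    case (real L)
    then have L: "1 \<le> L" using assms(1) by simp
    \<comment> \<open>This is the constant of \<open>risk_terms_le\<close>; the conversion from
      \<open>k\<close> to \<open>n\<close> multiplies it by 4.\<close>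
    define A where "A = 1064 + 5184 * L ^ 4 + 216 * (1 + \<sigma>\<^sup>2) + 96 * L\<^sup>2"
    have A: "0 < A" unfolding A_def by (intro add_pos_nonneg) auto
    \<comment> \<open>The given estimator runs on blocks, so the asymptotic assumptions are needed
      at sample size \<open>k ^ 3\<close>, with \<open>k\<close> itself tending to infinity as the
      fourth root of \<open>n\<close>.\<close>
    have cube: "filterlim (\<lambda>k::nat. k ^ 3) sequentially sequentially"
      by (intro filterlim_subseq strict_monoI power_strict_mono) auto
    have "\<forall>\<^sub>F k in sequentially. real k ^ 2 \<le> 2 ^ k" by real_asymp
    then have sq: "\<forall>\<^sub>F k in sequentially. k\<^sup>2 \<le> 2 ^ k"
      by eventually_elim (metis of_nat_le_iff of_nat_numeral of_nat_power)
    \<comment> \<open>At sample size \<open>k ^ 3\<close> the accuracy is \<open>k^(-3/4)\<close>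
      times a constant and a power of the logarithm; the spare factor \<open>k^(-1/4)\<close>
      absorbs both.\<close>
    have rk: "\<forall>\<^sub>F k in sequentially. r (k ^ 3) \<le> real k powr (- (1/2))"
      unfolding r_def of_nat_power using assms(7,8) by real_asymp
    have "\<forall>\<^sub>F k in sequentially. 1 \<le> k \<and> k\<^sup>2 \<le> 2 ^ k \<and> r (k ^ 3) \<le> real k powr (- (1/2)) \<and> \<delta> (k ^ 3) \<le> 1/15 \<and>
        (\<forall>f\<in>F_INV_Lip \<Lambda>. 1 - \<delta> (k ^ 3) \<le> Linf_error_prob p \<sigma> (k ^ 3) (fhat1 (k ^ 3)) f (r (k ^ 3)))"
      by (intro eventually_conj eventually_ge_at_top sq rk
            eventually_compose_filterlim[OF \<delta> cube] eventually_compose_filterlim[OF hyp cube])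
    from eventually_compose_filterlim[OF this filterlim_fourth_root_floor] eventually_ge_at_top[of 3]
    have "\<forall>\<^sub>F n in sequentially. (INF g\<in>estimators n. SUP f\<in>F_INV_Lip \<Lambda>. inverse_risk (\<lambda>z. z ^ 4) c p \<sigma> n g f)
        \<le> ennreal (4 * A * real n powr (- (2 / (2 + 2))) * ln (real n) powr (2 * \<alpha> + 2 * \<beta>))" if "0 < \<beta>" for \<beta>
    proof eventually_elim
      case (elim n)
      define k where "k = fourth_root_floor n"
      have k: "1 \<le> k" "k\<^sup>2 \<le> 2 ^ k" "r (k ^ 3) \<le> real k powr (- (1/2))" "\<delta> (k ^ 3) \<le> 1/15"
        "\<And>f. f \<in> F_INV_Lip \<Lambda> \<Longrightarrow> 1 - \<delta> (k ^ 3) \<le> Linf_error_prob p \<sigma> (k ^ 3) (fhat1 (k ^ 3)) f (r (k ^ 3))"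
        using elim(1) by (simp_all add: k_def)
      note nk = fourth_root_floor_bounds[of n, folded k_def]
      obtain \<A> where \<A>: "cell_partition (2 / k) \<A>" "card \<A> \<le> 9 * k\<^sup>2"
        using cell_partition_grid[of k] k(1) by auto
      have km: "k * k ^ 3 \<le> n" using nk(1) by (simp add: power_Suc[symmetric] del: power_Suc)
      \<comment> \<open>The bound is used with \<open>k\<close> blocks of \<open>k ^ 3\<close>
        observations, net resolution \<open>1 / k\<close> and cell diameter \<open>2 / k\<close>,
        the coarsest orders compatible with a squared error of order \<open>k^(-2)\<close>.\<close>
      have "(INF g\<in>estimators n. SUP f\<in>F_INV_Lip \<Lambda>. inverse_risk (\<lambda>z. z ^ 4) c p \<sigma> n g f)
        \<le> ennreal (8 * (1 / real k)\<^sup>2 + 4 * (L * (4 * r (k ^ 3) + 2 * (1 / real k))) ^ 4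
          + 12 * (real (card \<A>) * (2 * (1 + \<sigma>\<^sup>2)) / n + 2 * (L * (2 / real k))\<^sup>2) + 1056 * (1/2) ^ k)"
        unfolding real
        by (rule minimax_inverse_risk_le[OF p \<sigma> L _ r0 _ assms(5) km \<A>(1) k(5)[unfolded real] k(4)])
           (use k(1) elim(2) in auto)
      also have "\<dots> \<le> ennreal (A * (1 / (real k)\<^sup>2))"
        using risk_terms_le[OF k(1,2) nk(1) L r0 k(3) \<A>(2), of \<sigma>] by (intro ennreal_leI) (simp add: A_def)
      also have "\<dots> \<le> ennreal (A * (4 * real n powr (- (2 / (2 + 2))) * ln (real n) powr (2 * \<alpha> + 2 * \<beta>)))"
        using A inverse_square_le_rate[OF k(1) nk(2) elim(2), of "2 * \<alpha> + 2 * \<beta>"] that assms(8)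
        by (intro ennreal_leI mult_left_mono) auto
      finally show ?case by (simp add: mult_ac)
    qed
    then show ?thesis using A by (intro allI impI exI[of _ "4 * A"]) auto
  qed
qed

end
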